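(* For every $0\le\varepsilon\le2$, $$\widehat I_{-1}(\varepsilon)\le\mathcal F_\varepsilon(\boldsymbol w_{\rho_*})\le2b_*+24\pi\Big(1-\frac\varepsilon2\Big)-\delta_* .$$
   Context: Let $\boldsymbol e_3=(0,0,1)$ and $\mathcal A=\{\boldsymbol m:\mathbb R^2\to\mathbb S^2:\ \boldsymbol m-\boldsymbol e_3\in H^2(\mathbb R^2;\mathbb R^3)\}$. $Q(\boldsymbol m)=\frac1{4\pi}\int_{\mathbb R^2}\boldsymbol m\cdot(\partial_1\boldsymbol m\times\partial_2\boldsymbol m)\,dx\in\mathbb Z$ is the topological degree and $\mathcal A_{-1}=\{\boldsymbol m\in\mathcal A:Q(\boldsymbol m)=-1\}$. For $0\le\varepsilon\le2$, $$\mathcal F_\varepsilon(\boldsymbol n)=\frac12\int_{\mathbb R^2}\big(|\Delta\boldsymbol n|^2+|\boldsymbol n-\boldsymbol e_3|^2-\varepsilon|\nabla\boldsymbol n|^2\big)dx,\qquad\widehat I_{-1}(\varepsilon)=\inf_{\mathcal A_{-1}}\mathcal F_\varepsilon .$$ $J_0,J_1$ are Bessel functions of the first kind, $r_*$ is the first positive zero of $J_1$, and $b_*=\dfrac{8\pi J_0(r_* )^2}{1-J_0(r_* )^2}$. Trial map: for $\rho>0$, in polar coordinates $(r,\varphi)$ on $\mathbb R^2$, $$\boldsymbol w_\rho(r,\varphi)=\big(\sin f(r/\rho)\cos\varphi,\ \sin f(r/\rho)\sin\varphi,\ \cos f(r/\rho)\big),\qquad f(t)=\begin{cases}\pi(1-t)^2,&0\le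 t\le1,\\0,&t\ge1.\end{cases}$$ Set $$D_0=\frac12\int_{\mathbb R^2}|\nabla\boldsymbol w_1|^2dx,\quad A_0=\int_{\mathbb R^2}|\Delta\boldsymbol w_1|^2dx,\quad P_0=\int_{\mathbb R^2}|\boldsymbol w_1-\boldsymbol e_3|^2dx,\quad\rho_*=\Big(\frac{A_0}{P_0}\Big)^{1/4},$$ and define the (positive) constant $\delta_*=2b_*-\big(\sqrt{A_0P_0}-2D_0\big)$. *)

theory Defs
  imports "HOL-Analysis.Analysis"
begin

section \<open>Weak derivatives and \<open>H\<^sup>2\<close>\<close>

definition partial :: "'n::finite \<Rightarrow> (real^'n \<Rightarrow> real) \<Rightarrow> real^'n \<Rightarrow> real" where
  "partial i \<phi> x = frechet_derivative \<phi> (at x) (axis i 1)"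

text \<open>\<open>Ck k \<phi>\<close>: \<open>\<phi>\<close> is of class \<open>C\<^sup>k\<close> on the whole space.\<close>

primrec Ck :: "nat \<Rightarrow> (real^'n::finite \<Rightarrow> real) \<Rightarrow> bool" where
  "Ck 0 \<phi> \<longleftrightarrow> continuous_on UNIV \<phi>"
| "Ck (Suc k) \<phi> \<longleftrightarrow> (\<forall>x. \<phi> differentiable (at x)) \<and> (\<forall>i. Ck k (partial i \<phi>))"

definition test_function :: "(real^'n::finite \<Rightarrow> real) \<Rightarrow> bool" where
  "test_function \<phi> \<longleftrightarrow> (\<forall>k. Ck k \<phi>) \<and> compact (closure {x. \<phi> x \<noteq> 0})"

definition locally_integrable :: "(real^'n::finite \<Rightarrow> 'b::euclidean_space) \<Rightarrow> bool" where
  "locally_integrable u \<longleftrightarrow> (\<forall>K. compact K \<longrightarrow> set_integrable lebesgue K u)"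

definition has_weak_partial ::
  "'n::finite \<Rightarrow> (real^'n \<Rightarrow> 'b::euclidean_space) \<Rightarrow> (real^'n \<Rightarrow> 'b) \<Rightarrow> bool" where
  "has_weak_partial i u v \<longleftrightarrow> locally_integrable u \<and> locally_integrable v \<and>
     (\<forall>\<phi>. test_function \<phi> \<longrightarrow>
        (LINT x|lebesgue. partial i \<phi> x *\<^sub>R u x) = - (LINT x|lebesgue. \<phi> x *\<^sub>R v x))"

text \<open>
  A weak partial derivative is unique up to null sets. The operator below picks one representative
  (an arbitrary function if there is none); it is only used below integrals.
\<close>

definition weak_partial ::
  "'n::finite \<Rightarrow> (real^'n \<Rightarrow> 'b::euclidean_space) \<Rightarrow> real^'n \<Rightarrow> 'b" where
  "weak_partial i u = (SOME v. has_weak_partial i u v)"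

definition weak_laplacian :: "(real^'n::finite \<Rightarrow> 'b::euclidean_space) \<Rightarrow> real^'n \<Rightarrow> 'b" where
  "weak_laplacian u x = (\<Sum>i\<in>UNIV. weak_partial i (weak_partial i u) x)"

definition weak_grad_sq :: "(real^'n::finite \<Rightarrow> 'b::euclidean_space) \<Rightarrow> real^'n \<Rightarrow> real" where
  "weak_grad_sq u x = (\<Sum>i\<in>UNIV. (norm (weak_partial i u x))\<^sup>2)"

definition L2 :: "(real^'n::finite \<Rightarrow> 'b::euclidean_space) set" where
  "L2 = {u. u \<in> borel_measurable lebesgue \<and> integrable lebesgue (\<lambda>x. (norm (u x))\<^sup>2)}"

definition H1 :: "(real^'n::finite \<Rightarrow> 'b::euclidean_space) set" where
  "H1 = {u \<in> L2. \<forall>i. \<exists>v\<in>L2. has_weak_partial i u v}"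

definition H2 :: "(real^'n::finite \<Rightarrow> 'b::euclidean_space) set" where
  "H2 = {u \<in> L2. \<forall>i. \<exists>v\<in>H1. has_weak_partial i u v}"

section \<open>Admissible maps, degree and energy\<close>

definition e3 :: "real^3" where
  "e3 = vector [0, 0, 1]"

text \<open>
  The sphere constraint is imposed at every point; every class of maps satisfying it almost
  everywhere has such a representative, and degree and energy depend only on the class.
\<close>

definition admissible :: "(real^2 \<Rightarrow> real^3) set" where
  "admissible = {m. (\<forall>x. m x \<in> sphere 0 1) \<and> (\<lambda>x. m x - e3) \<in> H2}"

definition top_degree :: "(real^2 \<Rightarrow> real^3) \<Rightarrow> real" where
  "top_degree m = 1 / (4 * pi) *
     (LINT x|lebesgue. m x \<bullet> cross3 (weak_partial 1 m x) (weak_partial 2 m x))"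

definition admissible_deg :: "int \<Rightarrow> (real^2 \<Rightarrow> real^3) set" where
  "admissible_deg d = {m \<in> admissible. top_degree m = of_int d}"

definition energy :: "real \<Rightarrow> (real^2 \<Rightarrow> real^3) \<Rightarrow> real" where
  "energy \<epsilon> n = 1 / 2 *
     (LINT x|lebesgue. (norm (weak_laplacian n x))\<^sup>2 + (norm (n x - e3))\<^sup>2 - \<epsilon> * weak_grad_sq n x)"

text \<open>The infimum is taken in the extended reals, where it always has its usual meaning.\<close>

definition min_energy :: "int \<Rightarrow> real \<Rightarrow> ereal" where
  "min_energy d \<epsilon> = (INF m\<in>admissible_deg d. ereal (energy \<epsilon> m))"

section \<open>Bessel functions and the constant \<open>b\<^sub>*\<close>\<close>

definition bessel_J :: "nat \<Rightarrow> real \<Rightarrow> real" where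
  "bessel_J n x = (\<Sum>k. (-1)^k / (fact k * fact (k + n)) * (x / 2)^(2 * k + n))"

definition r_star :: real where
  "r_star = (LEAST r. 0 < r \<and> bessel_J 1 r = 0)"

definition b_star :: real where
  "b_star = 8 * pi * (bessel_J 0 r_star)\<^sup>2 / (1 - (bessel_J 0 r_star)\<^sup>2)"

section \<open>The trial map\<close>

definition profile :: "real \<Rightarrow> real" where
  "profile t = (if t \<le> 1 then pi * (1 - t)\<^sup>2 else 0)"

text \<open>
  In Cartesian coordinates, with \<open>cos \<phi> = x\<^sub>1 / r\<close> and \<open>sin \<phi> = x\<^sub>2 / r\<close>. At the origin the
  first two components vanish, as they should since \<open>sin (profile 0) = 0\<close>.
\<close>

definition trial_map :: "real \<Rightarrow> real^2 \<Rightarrow> real^3" where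
  "trial_map \<rho> x =
     vector [sin (profile (norm x / \<rho>)) * (x $ 1 / norm x),
             sin (profile (norm x / \<rho>)) * (x $ 2 / norm x),
             cos (profile (norm x / \<rho>))]"

lemma trial_map_polar:
  assumes "0 \<le> r"
  shows "trial_map \<rho> (vector [r * cos \<phi>, r * sin \<phi>]) =
    vector [sin (profile (r / \<rho>)) * cos \<phi>, sin (profile (r / \<rho>)) * sin \<phi>, cos (profile (r / \<rho>))]"
proof -
  have "(norm (vector [r * cos \<phi>, r * sin \<phi>] :: real^2))\<^sup>2 = (r * cos \<phi>)\<^sup>2 + (r * sin \<phi>)\<^sup>2"
    unfolding power2_norm_eq_inner by (simp add: inner_vec_def sum_2 power2_eq_square)
  also have "\<dots> = r\<^sup>2"
    by (simp add: power_mult_distrib flip: distrib_left)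
  finally have "norm (vector [r * cos \<phi>, r * sin \<phi>] :: real^2) = r"
    using assms by (simp add: power2_eq_iff_nonneg)
  then show ?thesis
    by (cases "r = 0") (simp_all add: trial_map_def profile_def)
qed

definition D0 :: real where
  "D0 = 1 / 2 * (LINT x|lebesgue. weak_grad_sq (trial_map 1) x)"

definition A0 :: real where
  "A0 = (LINT x|lebesgue. (norm (weak_laplacian (trial_map 1) x))\<^sup>2)"

definition P0 :: real where
  "P0 = (LINT x|lebesgue. (norm (trial_map 1 x - e3))\<^sup>2)"

definition rho_star :: real where
  "rho_star = root 4 (A0 / P0)"

definition delta_star :: real where
  "delta_star = 2 * b_star - (sqrt (A0 * P0) - 2 * D0)"

end

theory Submission
  imports Defs
begin

text \<open>
  The term \<open>2 b\<^sub>*\<close> cancels against \<open>\<delta>\<^sub>*\<close>. By scaling, the energy of \<open>w\<^sub>\<rho>\<close> is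
  \<open>(A\<^sub>0 / \<rho>\<^sup>2 + \<rho>\<^sup>2 P\<^sub>0) / 2 - \<epsilon> D\<^sub>0\<close>, which at \<open>\<rho>\<^sub>*\<close> is \<open>\<surd>(A\<^sub>0 P\<^sub>0) - \<epsilon> D\<^sub>0\<close>, so the upper bound
  amounts to \<open>D\<^sub>0 \<le> 12 \<pi>\<close>. This holds because \<open>\<bar>\<nabla>w\<bar>\<^sup>2 = f'\<^sup>2 + (sin f / r)\<^sup>2\<close> with \<open>f' = - 2 \<pi> (1 - r)\<close> and
  \<open>sin\<^sup>2 f \<le> \<bar>sin f\<bar> \<le> 2 \<pi> r\<close>, whence \<open>D\<^sub>0 \<le> \<pi>\<^sup>3 / 3 + 2 \<pi>\<^sup>2\<close>.

  The map and its gradient are Lipschitz, smooth off a null set (the origin and a circle), and constant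
  outside a disc, so the weak derivatives up to order two are the pointwise ones. The degree density
  is \<open>f' sin f / r\<close>, whose integral is \<open>- 4 \<pi>\<close>. Finally \<open>A\<^sub>0 > 0\<close>, as \<open>w \<bullet> \<Delta>w = - \<bar>\<nabla>w\<bar>\<^sup>2\<close>.
\<close>

section \<open>Weak derivatives of Lipschitz functions\<close>

text \<open>\<open>weak_partial\<close> is an arbitrary choice among weak derivatives, so no energy
  or degree can be evaluated before weak derivatives are known to be unique up to null sets. This
  forces the fundamental lemma of the calculus of variations, and with it a supply of compactly
  supported functions that are smooth in the sense of \<open>Ck\<close>. Lipschitz regularity is the
  natural level for the trial map. The second derivative of the profile f jumps at 1, and f''(0) = 2
  pi is nonzero, so w has a term proportional to r x near the origin, whose second derivatives are
  bounded but depend on the direction of x. The gradient is thus Lipschitz without being of class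
  C^1. One theorem on Lipschitz functions, applied to the map and then to its gradient, covers both
  orders of differentiation. The constants \<open>A0\<close> and \<open>P0\<close> stay symbolic;
  only their positivity matters, because it makes \<open>rho_star\<close> a genuine positive
  radius.\<close>

lemma tendsto_poly_mult_exp_minus_at_top: "((\<lambda>x::real. poly p x * exp (- x)) \<longlongrightarrow> 0) at_top"
proof -
  have "(\<lambda>x. poly p x * exp (- x)) = (\<lambda>x. \<Sum>i\<le>degree p. coeff p i * (x ^ i / exp x))"
    by (simp add: poly_altdef sum_distrib_right exp_minus divide_inverse fun_eq_iff mult.assoc)
  moreover have "((\<lambda>x. \<Sum>i\<le>degree p. coeff p i * (x ^ i / exp x)) \<longlongrightarrow> (\<Sum>i\<le>degree p. coeff p i * 0)) at_top"
    by (intro tendsto_intros tendsto_power_div_exp_0)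
  ultimately show ?thesis by simp
qed

text \<open>The standard flat function e^(-1/t), multiplied by a polynomial in 1/t. Allowing every
  polynomial makes the family closed under differentiation.\<close>

definition flat :: "real poly \<Rightarrow> real \<Rightarrow> real" where
  "flat p t = (if t > 0 then poly p (1 / t) * exp (- (1 / t)) else 0)"

text \<open>With s = 1/t one has ds/dt = -s^2, so the derivative of p(s) e^(-s) is s^2 (p(s) -
  p'(s)) e^(-s); the polynomial \<open>[:0, 0, 1:]\<close> is s^2.\<close>

lemma DERIV_flat:
  "(flat p has_real_derivative flat ([:0, 0, 1:] * (p - pderiv p)) t) (at t)"
proof (cases t "0::real" rule: linorder_cases)
  case less
  have "((\<lambda>_. 0) has_real_derivative 0) (at t)" by simp
  then have "(flat p has_real_derivative 0) (at t)"
    by (rule has_field_derivative_transform_within_open[where S="{..<0}"])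
       (use less in \<open>auto simp: flat_def\<close>)
  then show ?thesis using less by (simp add: flat_def)
next
  case equal
  have R: "((\<lambda>h. flat p h / h) \<longlongrightarrow> 0) (at_right 0)"
  proof -
    \<comment> \<open>Dividing by h multiplies by s = 1/h, which \<open>pCons 0 p\<close> absorbs
      into the polynomial.\<close>
    have "((\<lambda>h. poly (pCons 0 p) (inverse h) * exp (- (inverse h))) \<longlongrightarrow> 0) (at_right (0::real))"
      by (rule filterlim_compose[OF tendsto_poly_mult_exp_minus_at_top filterlim_inverse_at_top_right])
    then show ?thesis
      by (rule Lim_transform_eventually)
         (auto simp: eventually_at_right_field flat_def field_simps intro!: exI[of _ 1])
  qed
  have L: "((\<lambda>h. flat p h / h) \<longlongrightarrow> 0) (at_left 0)"
    by (rule tendsto_eventually)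
       (auto simp: eventually_at_left_field flat_def intro!: exI[of _ "-1"])
  have "((\<lambda>h. flat p h / h) \<longlongrightarrow> 0) (at 0)"
    using R L by (simp add: filterlim_at_split)
  then show ?thesis
    using equal by (simp add: DERIV_def flat_def)
next
  case greater
  have "((\<lambda>t. poly p (1 / t) * exp (- (1 / t))) has_real_derivative
      poly ([:0, 0, 1:] * (p - pderiv p)) (1 / t) * exp (- (1 / t))) (at t)"
    using greater
    by (auto intro!: derivative_eq_intros DERIV_chain2[of "poly p"] poly_DERIV
        simp: power2_eq_square field_simps)
  then have "(flat p has_real_derivative
      poly ([:0, 0, 1:] * (p - pderiv p)) (1 / t) * exp (- (1 / t))) (at t)"
    by (rule has_field_derivative_transform_within_open[where S="{0<..}"])
       (use greater in \<open>auto simp: flat_def\<close>)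
  then show ?thesis using greater by (simp add: flat_def)
qed

lemma partial_eq: "(f has_derivative D) (at x) \<Longrightarrow> partial i f x = D (axis i 1)"
  by (simp add: partial_def frechet_derivative_at[symmetric])

text \<open>An algebra of functions that contains the bumps and is closed under partial derivatives,
  so that all its elements are smooth.\<close>

inductive_set flat_algebra :: "(real^'n::finite \<Rightarrow> real) set" where
  const: "(\<lambda>_. c) \<in> flat_algebra"
| flat: "(\<lambda>x. flat p (c * x $ i + d)) \<in> flat_algebra"
| add: "f \<in> flat_algebra \<Longrightarrow> g \<in> flat_algebra \<Longrightarrow> (\<lambda>x. f x + g x) \<in> flat_algebra"
| mult: "f \<in> flat_algebra \<Longrightarrow> g \<in> flat_algebra \<Longrightarrow> (\<lambda>x. f x * g x) \<in> flat_algebra"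

lemma flat_algebra_partial:
  fixes f :: "real^'n::finite \<Rightarrow> real"
  assumes "f \<in> flat_algebra"
  shows "(\<forall>x. f differentiable (at x)) \<and> (\<forall>i. partial i f \<in> flat_algebra)"
  using assms
proof induction
  case (const c)
  have "partial i (\<lambda>_::real^'n. c) = (\<lambda>_. 0)" for i
    by (rule ext, subst partial_eq[OF has_derivative_const]) simp
  then show ?case by (simp add: flat_algebra.const)
next
  case (flat p c i d)
  have D: "((\<lambda>x::real^'n. flat p (c * x $ i + d)) has_derivative
      (\<lambda>h. (c * h $ i) * flat ([:0, 0, 1:] * (p - pderiv p)) (c * x $ i + d))) (at x)" for x
    by (rule DERIV_compose_FDERIV[OF DERIV_flat])
       (auto intro!: derivative_eq_intros bounded_linear_imp_has_derivative bounded_linear_vec_nth)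
  have "partial j (\<lambda>x::real^'n. flat p (c * x $ i + d)) =
      (\<lambda>x. (c * (axis j 1 :: real^'n) $ i) * flat ([:0, 0, 1:] * (p - pderiv p)) (c * x $ i + d))" for j
    by (rule ext, subst partial_eq[OF D]) simp
  then show ?case
    using D by (auto intro: flat_algebra.intros differentiableI)
next
  case (add f g)
  have "partial i (\<lambda>x. f x + g x) = (\<lambda>x. partial i f x + partial i g x)" for i
    using add.IH by (auto intro!: ext partial_eq[THEN trans] derivative_eq_intros
        simp: partial_def frechet_derivative_works[symmetric])
  then show ?case
    using add by (auto intro: flat_algebra.intros)
next
  case (mult f g)
  have "partial i (\<lambda>x. f x * g x) = (\<lambda>x. f x * partial i g x + partial i f x * g x)" for i
    using mult.IH by (auto intro!: ext partial_eq[THEN trans, OF has_derivative_mult]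
        simp: partial_def frechet_derivative_works[symmetric])
  then show ?case
    using mult by (auto intro!: flat_algebra.add flat_algebra.mult)
qed

lemma Ck_flat_algebra: "f \<in> flat_algebra \<Longrightarrow> Ck k f"
proof (induction k arbitrary: f)
  case 0
  then show ?case
    using flat_algebra_partial[of f]
    by (auto intro!: differentiable_imp_continuous_on simp: differentiable_on_def
        intro: differentiable_at_withinI)
next
  case (Suc k)
  then show ?case using flat_algebra_partial[of f] by simp
qed

lemma prod_flat_algebra:
  assumes "\<And>i. i \<in> I \<Longrightarrow> f i \<in> flat_algebra"
  shows "(\<lambda>x. \<Prod>i\<in>I. f i x) \<in> flat_algebra"
  using assms by (induction I rule: infinite_finite_induct) (auto intro: flat_algebra.intros)

text \<open>The factor \<open>Suc n\<close> steepens the walls: e^(-1/s) tends to 1 as s grows, so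
  these products converge pointwise to the indicator of the open box while staying between 0 and
  1.\<close>

definition box_bump :: "real^'n::finite \<Rightarrow> real^'n \<Rightarrow> nat \<Rightarrow> real^'n \<Rightarrow> real" where
  "box_bump a b n x =
     (\<Prod>i\<in>UNIV. flat 1 (Suc n * (x $ i - a $ i)) * flat 1 (Suc n * (b $ i - x $ i)))"

lemma flat_1_nonneg: "0 \<le> flat 1 t" and flat_1_le_1: "flat 1 t \<le> 1"
  by (auto simp: flat_def)

lemma box_bump_nonneg: "0 \<le> box_bump a b n x"
  unfolding box_bump_def by (intro prod_nonneg ballI mult_nonneg_nonneg flat_1_nonneg)

lemma box_bump_le_1: "box_bump a b n x \<le> 1"
  unfolding box_bump_def
  by (intro prod_le_1 conjI mult_nonneg_nonneg flat_1_nonneg mult_le_one flat_1_le_1)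

lemma box_bump_eq_0: "x \<notin> box a b \<Longrightarrow> box_bump a b n x = 0"
proof -
  assume "x \<notin> box a b"
  then obtain i where "x $ i \<le> a $ i \<or> b $ i \<le> x $ i"
    by (auto simp: mem_box_cart not_less)
  then have "flat 1 (Suc n * (x $ i - a $ i)) * flat 1 (Suc n * (b $ i - x $ i)) = 0"
    by (auto simp: flat_def zero_less_mult_iff)
  then show ?thesis
    unfolding box_bump_def by (intro prod_zero) auto
qed

lemma box_bump_tendsto: "(\<lambda>n. box_bump a b n x) \<longlonglongrightarrow> indicator (box a b) x"
proof (cases "x \<in> box a b")
  case True
  have F: "(\<lambda>n. flat 1 (Suc n * t)) \<longlonglongrightarrow> 1" if "0 < t" for t :: real
  proof -
    have "(\<lambda>n. exp (- (inverse (real (Suc n)) * (1 / t)))) \<longlonglongrightarrow> exp (- (0 * (1 / t)))"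
      by (intro tendsto_intros LIMSEQ_inverse_real_of_nat)
    moreover have "flat 1 (Suc n * t) = exp (- (inverse (real (Suc n)) * (1 / t)))" for n
      using that by (simp add: flat_def zero_less_mult_iff divide_inverse)
    ultimately show ?thesis by simp
  qed
  have "(\<lambda>n. box_bump a b n x) \<longlonglongrightarrow> (\<Prod>i\<in>(UNIV::'a set). 1 * 1)"
    unfolding box_bump_def
    using True by (intro tendsto_prod tendsto_mult F) (auto simp: mem_box_cart)
  then show ?thesis using True by simp
qed (simp add: box_bump_eq_0)

lemma test_function_box_bump: "test_function (box_bump a b n)"
proof -
  have "(\<lambda>x. flat 1 (real (Suc n) * x $ i + (- (real (Suc n) * a $ i)))
      * flat 1 ((- real (Suc n)) * x $ i + real (Suc n) * b $ i)) \<in> flat_algebra" for i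
    by (intro flat_algebra.intros)
  from prod_flat_algebra[of UNIV, OF this]
  have "box_bump a b n \<in> flat_algebra"
    unfolding box_bump_def[abs_def] by (simp add: algebra_simps)
  moreover have "bounded {x. box_bump a b n x \<noteq> 0}"
    by (rule bounded_subset[OF bounded_box[of a b]]) (use box_bump_eq_0 in blast)
  ultimately show ?thesis
    by (simp add: test_function_def Ck_flat_algebra)
qed

section \<open>Integrability against test functions\<close>

lemma test_function_continuous: "test_function \<phi> \<Longrightarrow> continuous_on UNIV \<phi>"
  unfolding test_function_def by (metis Ck.simps(1))

lemma borel_measurable_lebesgue_continuous:
  fixes f :: "'a::euclidean_space \<Rightarrow> 'b::euclidean_space"
  assumes "continuous_on UNIV f"
  shows "f \<in> borel_measurable lebesgue"
  using assms by (intro measurable_completion) (simp add: borel_measurable_continuous_onI)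

lemma bounded_continuous_compact_support:
  fixes f :: "'a::euclidean_space \<Rightarrow> 'b::real_normed_vector"
  assumes "continuous_on UNIV f" "compact K" "\<And>x. x \<notin> K \<Longrightarrow> f x = 0"
  obtains B where "0 \<le> B" "\<And>x. norm (f x) \<le> B"
proof -
  have "bounded (f ` K)"
    using assms by (intro compact_imp_bounded compact_continuous_image) (auto intro: continuous_on_subset)
  then obtain B where B: "\<And>x. x \<in> K \<Longrightarrow> norm (f x) \<le> B"
    by (auto simp: bounded_iff)
  show thesis
  proof (rule that[of "max B 0"])
    show "norm (f x) \<le> max B 0" for x
      using B[of x] assms(3)[of x] by (cases "x \<in> K") auto
  qed simp
qed

lemma test_function_support:
  assumes "test_function \<phi>"
  obtains K where "compact K" "\<And>x. x \<notin> K \<Longrightarrow> \<phi> x = 0"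
proof
  show "compact (closure {x. \<phi> x \<noteq> 0})"
    using assms by (simp add: test_function_def)
  show "\<phi> x = 0" if "x \<notin> closure {x. \<phi> x \<noteq> 0}" for x
    using that closure_subset[of "{x. \<phi> x \<noteq> 0}"] by blast
qed

text \<open>Stated for continuous \<open>\<phi>\<close> with compact support so that it also applies
  directly to translates of a test function.\<close>

lemma integrable_scaleR_locally_integrable:
  fixes v :: "real^'n::finite \<Rightarrow> 'b::euclidean_space" and \<phi> :: "real^'n \<Rightarrow> real"
  assumes "continuous_on UNIV \<phi>" "compact K" "\<And>x. x \<notin> K \<Longrightarrow> \<phi> x = 0" "locally_integrable v"
  shows "integrable lebesgue (\<lambda>x. \<phi> x *\<^sub>R v x)"
proof -
  obtain B where B: "0 \<le> B" "\<And>x. norm (\<phi> x) \<le> B"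
    using bounded_continuous_compact_support[OF assms(1-3)] by blast
  have I: "integrable lebesgue (\<lambda>x. indicat_real K x *\<^sub>R v x)"
    using assms by (simp add: locally_integrable_def set_integrable_def)
  have "integrable lebesgue (\<lambda>x. \<phi> x *\<^sub>R (indicat_real K x *\<^sub>R v x))"
  proof (rule Bochner_Integration.integrable_bound)
    show "integrable lebesgue (\<lambda>x. B * norm (indicat_real K x *\<^sub>R v x))"
      using I by (intro integrable_mult_right integrable_norm)
    show "(\<lambda>x. \<phi> x *\<^sub>R (indicat_real K x *\<^sub>R v x)) \<in> borel_measurable lebesgue"
      using borel_measurable_lebesgue_continuous[OF assms(1)] borel_measurable_integrable[OF I]
      by (rule borel_measurable_scaleR)
    show "AE x in lebesgue. norm (\<phi> x *\<^sub>R indicat_real K x *\<^sub>R v x)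
        \<le> norm (B * norm (indicat_real K x *\<^sub>R v x))"
    proof (intro always_eventually allI)
      fix x
      have "norm (\<phi> x *\<^sub>R indicat_real K x *\<^sub>R v x) \<le> B * norm (indicat_real K x *\<^sub>R v x)"
        unfolding norm_scaleR[of "\<phi> x"] using B(2)[of x] by (intro mult_right_mono) auto
      then show "norm (\<phi> x *\<^sub>R indicat_real K x *\<^sub>R v x) \<le> norm (B * norm (indicat_real K x *\<^sub>R v x))"
        using abs_ge_self order_trans real_norm_def by metis
    qed
  qed
  also have "(\<lambda>x. \<phi> x *\<^sub>R (indicat_real K x *\<^sub>R v x)) = (\<lambda>x. \<phi> x *\<^sub>R v x)"
    using assms(3) by (auto simp: fun_eq_iff indicator_def)
  finally show ?thesis .
qed

lemma integrable_test_function_scaleR: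
  assumes "test_function \<phi>" "locally_integrable v"
  shows "integrable lebesgue (\<lambda>x. \<phi> x *\<^sub>R v x)"
proof -
  obtain K where "compact K" "\<And>x. x \<notin> K \<Longrightarrow> \<phi> x = 0"
    using test_function_support[OF assms(1)] by blast
  then show ?thesis
    using test_function_continuous[OF assms(1)] assms(2)
    by (intro integrable_scaleR_locally_integrable)
qed

section \<open>The fundamental lemma and uniqueness of weak derivatives\<close>

lemma sigma_finite_lebesgue: "sigma_finite_measure (lebesgue :: 'a::euclidean_space measure)"
proof
  have "emeasure lebesgue (cball (0::'a) (real n)) \<noteq> \<infinity>" for n
    using emeasure_lborel_cball_finite[of "0::'a" "real n"] by simp
  moreover have "(\<Union>n. cball (0::'a) (real n)) = UNIV"
    by (auto simp: real_arch_simple)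
  ultimately show "\<exists>A. countable A \<and> A \<subseteq> sets (lebesgue :: 'a measure) \<and> \<Union> A = space lebesgue \<and>
      (\<forall>a\<in>A. emeasure (lebesgue :: 'a measure) a \<noteq> \<infinity>)"
    by (intro exI[of _ "range (\<lambda>n::nat. cball (0::'a) (real n))"]) auto
qed

text \<open>Open boxes are an intersection-stable generator of the Borel sets, so a Dynkin argument
  extends the vanishing integral to all Borel sets. The hypothesis \<open>total\<close> is what
  carries it through complements.\<close>

lemma AE_zero_if_box_integrals_zero:
  fixes v :: "'a::euclidean_space \<Rightarrow> 'b::euclidean_space"
  assumes v: "integrable lebesgue v"
    and box: "\<And>a b. (LINT x:box a b|lebesgue. v x) = 0"
    and total: "(LINT x|lebesgue. v x) = 0"
  shows "AE x in lebesgue. v x = 0"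
proof (rule sigma_finite_measure.density_zero[OF sigma_finite_lebesgue v])
  have si: "set_integrable lebesgue A v" if "A \<in> sets borel" for A
    unfolding set_integrable_def using that by (intro integrable_mult_indicator v) auto
  have borel: "(LINT x:A|lebesgue. v x) = 0" if "A \<in> sets borel" for A
  proof -
    have "Int_stable (range (\<lambda>(a, b). box a b :: 'a set))"
      by (auto simp: Int_stable_def box_Int_box)
    moreover have "range (\<lambda>(a, b). box a b :: 'a set) \<subseteq> Pow UNIV"
      by simp
    moreover have "A \<in> sigma_sets UNIV (range (\<lambda>(a, b). box a b :: 'a set))"
      using that by (subst (asm) borel_eq_box) simp
    ultimately show ?thesis
    proof (induction rule: sigma_sets_induct_disjoint)
      case (basic A)
      then show ?case using box by auto
    next
      case empty
      then show ?case by (simp add: set_lebesgue_integral_def)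
    next
      case (compl A)
      then have A: "A \<in> sets borel"
        by (subst borel_eq_box) simp
      have "(LINT x:A \<union> (UNIV - A)|lebesgue. v x) = (LINT x:A|lebesgue. v x) + (LINT x:UNIV - A|lebesgue. v x)"
        using A by (intro set_integral_Un si) auto
      moreover have "(LINT x:A \<union> (UNIV - A)|lebesgue. v x) = 0"
        using total by (simp add: set_lebesgue_integral_def)
      ultimately show ?case using compl by simp
    next
      case (union A)
      then have A: "A i \<in> sets borel" for i
        by (subst borel_eq_box) auto
      have "(LINT x:(\<Union>i. A i)|lebesgue. v x) = (\<Sum>i. (LINT x:(A i)|lebesgue. v x))"
        using A union(1) by (intro lebesgue_integral_countable_add si) (auto simp: disjoint_family_on_def)
      then show ?case using union by simp
    qed
  qed
  fix A :: "'a set" assume "A \<in> sets lebesgue"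
  \<comment> \<open>A Lebesgue set is a Borel set up to a subset of a null set, which the integral
    does not see.\<close>
  then obtain S N N' where A: "A = S \<union> N" "N \<subseteq> N'" "N' \<in> null_sets lborel" "S \<in> sets lborel"
    by (rule sets_completionE)
  have "N' \<in> null_sets lebesgue"
    using A by (simp add: null_sets_completionI)
  then have "AE x in lebesgue. x \<notin> N'"
    by (rule AE_not_in)
  then have "AE x in lebesgue. indicat_real A x *\<^sub>R v x = indicat_real S x *\<^sub>R v x"
    by eventually_elim (use A in \<open>auto simp: indicator_def\<close>)
  then have "(LINT x:A|lebesgue. v x) = (LINT x:S|lebesgue. v x)"
    unfolding set_lebesgue_integral_def
    using A \<open>A \<in> sets lebesgue\<close>
    by (intro integral_cong_AE borel_measurable_integrable integrable_mult_indicator v) auto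
  then show "(LINT x:A|lebesgue. v x) = 0"
    using borel A by simp
qed

text \<open>Dominated convergence along the bumps turns the hypothesis into vanishing integrals over
  boxes. As \<open>v\<close> is only locally integrable, the measure-theoretic criterion is applied
  to its restrictions to the cubes \<open>K N\<close>; the intersection of a box with a cube is
  again a box, and the cubes exhaust the space.\<close>

lemma fundamental_lemma_calculus_of_variations:
  fixes v :: "real^'n::finite \<Rightarrow> 'b::euclidean_space"
  assumes loc: "locally_integrable v"
    and zero: "\<And>\<phi>. test_function \<phi> \<Longrightarrow> (LINT x|lebesgue. \<phi> x *\<^sub>R v x) = 0"
  shows "AE x in lebesgue. v x = 0"
proof -
  have box: "(LINT x:box a b|lebesgue. v x) = 0" for a b
  proof -
    have I: "integrable lebesgue (\<lambda>x. indicat_real (cbox a b) x *\<^sub>R v x)"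
      using loc by (simp add: locally_integrable_def set_integrable_def)
    have I': "integrable lebesgue (\<lambda>x. indicat_real (box a b) x *\<^sub>R v x)"
      using set_integrable_subset[of lebesgue "cbox a b" v "box a b"] I box_subset_cbox[of a b]
      by (auto simp: set_integrable_def)
    have "(\<lambda>n. LINT x|lebesgue. box_bump a b n x *\<^sub>R v x) \<longlonglongrightarrow>
        (LINT x|lebesgue. indicat_real (box a b) x *\<^sub>R v x)"
    proof (rule integral_dominated_convergence)
      show "integrable lebesgue (\<lambda>x. norm (indicat_real (cbox a b) x *\<^sub>R v x))"
        using I by (rule integrable_norm)
      show "(\<lambda>x. box_bump a b n x *\<^sub>R v x) \<in> borel_measurable lebesgue" for n
        using integrable_test_function_scaleR[OF test_function_box_bump loc]
        by (rule borel_measurable_integrable)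
      show "AE x in lebesgue. (\<lambda>n. box_bump a b n x *\<^sub>R v x) \<longlonglongrightarrow> indicat_real (box a b) x *\<^sub>R v x"
        by (intro always_eventually allI tendsto_intros box_bump_tendsto)
      have "norm (box_bump a b n x *\<^sub>R v x) \<le> norm (indicat_real (cbox a b) x *\<^sub>R v x)" for n x
        using box_bump_eq_0[of x a b n] box_bump_le_1[of a b n x] box_bump_nonneg[of a b n x]
          box_subset_cbox[of a b]
        by (cases "x \<in> box a b") (auto simp: mult_left_le_one_le)
      then show "AE x in lebesgue. norm (box_bump a b n x *\<^sub>R v x) \<le> norm (indicat_real (cbox a b) x *\<^sub>R v x)" for n
        by simp
    qed (use I' in auto)
    then show ?thesis
      by (simp add: zero[OF test_function_box_bump] set_lebesgue_integral_def LIMSEQ_const_iff)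
  qed
  define K where "K N = box ((\<chi> i. - real N) :: real^'n) (\<chi> i. real N)" for N :: nat
  have "AE x in lebesgue. indicat_real (K N) x *\<^sub>R v x = 0" for N
  proof (rule AE_zero_if_box_integrals_zero)
    have "set_integrable lebesgue (cbox ((\<chi> i. - real N) :: real^'n) (\<chi> i. real N)) v"
      using loc by (simp add: locally_integrable_def)
    then have "set_integrable lebesgue (K N) v"
      unfolding K_def by (rule set_integrable_subset) (auto intro: box_subset_cbox[THEN subsetD])
    then show "integrable lebesgue (\<lambda>x. indicat_real (K N) x *\<^sub>R v x)"
      by (simp add: set_integrable_def)
    show "(LINT x|lebesgue. indicat_real (K N) x *\<^sub>R v x) = 0"
      using box by (simp add: K_def set_lebesgue_integral_def)
    show "(LINT x:box a b|lebesgue. indicat_real (K N) x *\<^sub>R v x) = 0" for a b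
    proof -
      obtain c d where "box a b \<inter> K N = box c d"
        unfolding K_def box_Int_box by blast
      moreover have "(LINT x:box a b|lebesgue. indicat_real (K N) x *\<^sub>R v x) = (LINT x:box a b \<inter> K N|lebesgue. v x)"
        by (simp add: set_lebesgue_integral_def indicator_inter_arith)
      ultimately show ?thesis using box by simp
    qed
  qed
  then have "AE x in lebesgue. \<forall>N. indicat_real (K N) x *\<^sub>R v x = 0"
    unfolding AE_all_countable by blast
  then show ?thesis
  proof eventually_elim
    case (elim x)
    obtain N :: nat where N: "norm x < N"
      using reals_Archimedean2 by blast
    have "\<bar>x $ i\<bar> < N" for i
      using component_le_norm_cart[of x i] N by linarith
    then have "x \<in> K N"
      by (auto simp: K_def mem_box_cart abs_less_iff minus_less_iff)
    then show ?case using elim by (auto dest: spec[of _ N])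
  qed
qed

lemma locally_integrable_diff:
  "locally_integrable u \<Longrightarrow> locally_integrable v \<Longrightarrow> locally_integrable (\<lambda>x. u x - v x)"
  by (auto simp: locally_integrable_def)

lemma has_weak_partial_unique:
  assumes "has_weak_partial i u v" "has_weak_partial i u v'"
  shows "AE x in lebesgue. v x = v' x"
proof -
  have loc: "locally_integrable v" "locally_integrable v'"
    using assms by (auto simp: has_weak_partial_def)
  have "AE x in lebesgue. v x - v' x = 0"
  proof (rule fundamental_lemma_calculus_of_variations[OF locally_integrable_diff[OF loc]])
    fix \<phi> :: "real^'a \<Rightarrow> real" assume \<phi>: "test_function \<phi>"
    show "(LINT x|lebesgue. \<phi> x *\<^sub>R (v x - v' x)) = 0"
      using assms \<phi> integrable_test_function_scaleR[OF \<phi> loc(1)] integrable_test_function_scaleR[OF \<phi> loc(2)]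
      by (simp add: scaleR_diff_right has_weak_partial_def)
  qed
  then show ?thesis by simp
qed

lemma has_weak_partial_weak_partial:
  "has_weak_partial i u v \<Longrightarrow> has_weak_partial i u (weak_partial i u)"
  unfolding weak_partial_def by (rule someI[where P = "has_weak_partial i u"])

text \<open>The bridge from the chosen representative to a concrete formula: any weak derivative
  that can be exhibited may replace \<open>weak_partial\<close> under an integral.\<close>

lemma weak_partial_AE_eq:
  "has_weak_partial i u v \<Longrightarrow> AE x in lebesgue. weak_partial i u x = v x"
  using has_weak_partial_unique has_weak_partial_weak_partial by blast

lemma locally_integrable_measurable:
  assumes "locally_integrable u"
  shows "u \<in> borel_measurable lebesgue"
proof (rule borel_measurable_LIMSEQ_metric)
  show "(\<lambda>x. indicat_real (cball 0 (real n)) x *\<^sub>R u x) \<in> borel_measurable lebesgue" for n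
    using assms
    by (intro borel_measurable_integrable) (simp add: locally_integrable_def set_integrable_def)
  show "(\<lambda>n. indicat_real (cball 0 (real n)) x *\<^sub>R u x) \<longlonglongrightarrow> u x" for x
  proof (rule tendsto_eventually)
    show "\<forall>\<^sub>F n in sequentially. indicat_real (cball 0 (real n)) x *\<^sub>R u x = u x"
      using eventually_ge_at_top[of "nat \<lceil>norm x\<rceil>"]
      by eventually_elim (simp add: nat_le_iff ceiling_le_iff)
  qed
qed

text \<open>\<open>weak_laplacian\<close> differentiates the chosen \<open>weak_partial i u\<close>,
  which agrees with the pointwise gradient only almost everywhere. This lemma transfers the second
  weak derivative across that gap.\<close>

lemma has_weak_partial_cong_AE:
  fixes u u' :: "real^'n::finite \<Rightarrow> 'b::euclidean_space"
  assumes "has_weak_partial i u v" "AE x in lebesgue. u' x = u x"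
  shows "has_weak_partial i u' v"
proof -
  have loc: "locally_integrable u"
    using assms by (simp add: has_weak_partial_def)
  have [measurable]: "u \<in> borel_measurable lebesgue"
    using loc by (rule locally_integrable_measurable)
  then have [measurable]: "u' \<in> borel_measurable lebesgue"
    by (rule borel_measurable_AE) (use assms(2) in auto)
  have "locally_integrable u'"
    unfolding locally_integrable_def
  proof (intro allI impI)
    fix K :: "(real^'n) set" assume K: "compact K"
    then have "set_integrable lebesgue K u" using loc by (simp add: locally_integrable_def)
    then show "set_integrable lebesgue K u'"
      unfolding set_integrable_def
    proof (rule integrable_cong_AE_imp)
      have "indicat_real K \<in> borel_measurable lebesgue"
        using K by (intro borel_measurable_indicator) (auto simp: compact_imp_closed)
      then show "(\<lambda>x. indicat_real K x *\<^sub>R u' x) \<in> borel_measurable lebesgue"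
        using \<open>u' \<in> borel_measurable lebesgue\<close> by (rule borel_measurable_scaleR)
      show "AE x in lebesgue. indicat_real K x *\<^sub>R u x = indicat_real K x *\<^sub>R u' x"
        using assms(2) by eventually_elim simp
    qed
  qed
  moreover have "(LINT x|lebesgue. partial i \<phi> x *\<^sub>R u' x) = (LINT x|lebesgue. partial i \<phi> x *\<^sub>R u x)"
    if "test_function \<phi>" for \<phi>
  proof -
    have [measurable]: "partial i \<phi> \<in> borel_measurable lebesgue"
      using that unfolding test_function_def
      by (intro borel_measurable_lebesgue_continuous) (metis Ck.simps)
    show ?thesis
      by (rule integral_cong_AE) (use assms(2) in auto)
  qed
  ultimately show ?thesis
    using assms by (simp add: has_weak_partial_def)
qed

section \<open>Affine substitution and difference quotients\<close>

text \<open>Serves twice: c = 1 gives the translation invariance behind integration by parts, t = 0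
  the scaling laws of the energy.\<close>

lemma lebesgue_integral_affine:
  fixes f :: "'a::euclidean_space \<Rightarrow> 'b::{banach, second_countable_topology}"
  assumes f: "f \<in> borel_measurable lebesgue" and c: "c \<noteq> 0"
  shows "(LINT x|lebesgue. f x) = \<bar>c\<bar> ^ DIM('a) *\<^sub>R (LINT x|lebesgue. f (t + c *\<^sub>R x))"
proof -
  \<comment> \<open>The map t + c x, written in coordinates to match the form of
    \<open>lebesgue_affine_euclidean\<close>.\<close>
  define T :: "'a \<Rightarrow> 'a" where "T x = t + (\<Sum>j\<in>Basis. (c * (x \<bullet> j)) *\<^sub>R j)" for x
  have T: "T x = t + c *\<^sub>R x" for x
    unfolding T_def scaleR_scaleR[symmetric] scaleR_sum_right[symmetric] euclidean_representation ..
  have meas: "T \<in> lebesgue \<rightarrow>\<^sub>M lebesgue"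
    unfolding T_def[abs_def] by (rule lebesgue_affine_measurable) (use c in simp)
  have "lebesgue = density (distr lebesgue lebesgue T) (\<lambda>_. \<bar>c\<bar> ^ DIM('a))"
    unfolding T_def[abs_def]
    by (subst lebesgue_affine_euclidean[of "\<lambda>_. c" t]) (use c in \<open>simp_all add: prod_constant\<close>)
  then have "(LINT x|lebesgue. f x) = (LINT x|density (distr lebesgue lebesgue T) (\<lambda>_. \<bar>c\<bar> ^ DIM('a)). f x)"
    by simp
  also have "\<dots> = (LINT x|distr lebesgue lebesgue T. \<bar>c\<bar> ^ DIM('a) *\<^sub>R f x)"
    using f by (subst integral_density) auto
  also have "\<dots> = (LINT x|lebesgue. \<bar>c\<bar> ^ DIM('a) *\<^sub>R f (T x))"
    using f meas by (subst integral_distr) auto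
  finally show ?thesis by (simp add: T)
qed

lemma lebesgue_integral_translation:
  fixes f :: "'a::euclidean_space \<Rightarrow> 'b::{banach, second_countable_topology}"
  assumes "f \<in> borel_measurable lebesgue"
  shows "(LINT x|lebesgue. f (t + x)) = (LINT x|lebesgue. f x)"
  using lebesgue_integral_affine[OF assms, of 1 t] by simp

lemma has_vector_derivative_quotient_tendsto:
  fixes f :: "real \<Rightarrow> 'b::real_normed_vector"
  assumes "(f has_vector_derivative v) (at 0)" "h \<longlonglongrightarrow> 0" "\<And>n. h n \<noteq> 0"
  shows "(\<lambda>n. (f (h n) - f 0) /\<^sub>R h n) \<longlonglongrightarrow> v"
proof -
  have "((\<lambda>t. norm (f t - f 0 - t *\<^sub>R v) / norm t) \<longlongrightarrow> 0) (at 0)"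
    using assms(1) by (simp add: has_vector_derivative_def has_derivative_at)
  moreover have "norm (f t - f 0 - t *\<^sub>R v) / norm t = norm ((f t - f 0) /\<^sub>R t - v)" if "t \<noteq> 0" for t
  proof -
    have "f t - f 0 - t *\<^sub>R v = t *\<^sub>R ((f t - f 0) /\<^sub>R t - v)"
      using that by (simp add: scaleR_diff_right)
    then show ?thesis using that by simp
  qed
  ultimately have "((\<lambda>t. norm ((f t - f 0) /\<^sub>R t - v)) \<longlongrightarrow> 0) (at 0)"
    by (elim Lim_transform_eventually) (auto simp: eventually_at_filter)
  then have "((\<lambda>t. (f t - f 0) /\<^sub>R t) \<longlongrightarrow> v) (at 0)"
    using tendsto_norm_zero_iff LIM_zero_cancel by blast
  then show ?thesis
    by (rule filterlim_compose) (use assms(2,3) in \<open>auto simp: filterlim_at\<close>)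
qed

lemma lipschitz_difference_quotient_le:
  fixes u :: "'a::real_normed_vector \<Rightarrow> 'b::real_normed_vector"
  assumes "L-lipschitz_on UNIV u" "norm e = 1" "h \<noteq> 0"
  shows "norm ((u (x + h *\<^sub>R e) - u x) /\<^sub>R h) \<le> L"
proof -
  have "norm (u (x + h *\<^sub>R e) - u x) \<le> L * \<bar>h\<bar>"
    using lipschitz_onD[OF assms(1), of "x + h *\<^sub>R e" x] assms(2) by (simp add: dist_norm)
  then have "norm (u (x + h *\<^sub>R e) - u x) / \<bar>h\<bar> \<le> L"
    using assms(3) by (simp add: pos_divide_le_eq)
  then show ?thesis
    by (simp add: divide_inverse_commute)
qed

lemma lipschitz_directional_derivative_le:
  fixes u :: "'a::real_normed_vector \<Rightarrow> 'b::real_normed_vector"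
  assumes "L-lipschitz_on UNIV u" "norm e = 1"
    and "((\<lambda>t. u (x + t *\<^sub>R e)) has_vector_derivative v) (at 0)"
  shows "norm v \<le> L"
proof (rule Lim_bounded)
  show "(\<lambda>n. norm ((u (x + inverse (real (Suc n)) *\<^sub>R e) - u (x + 0 *\<^sub>R e)) /\<^sub>R inverse (real (Suc n))))
      \<longlonglongrightarrow> norm v"
    by (intro tendsto_norm has_vector_derivative_quotient_tendsto[OF assms(3) LIMSEQ_inverse_real_of_nat]) simp
  show "\<forall>n\<ge>0. norm ((u (x + inverse (real (Suc n)) *\<^sub>R e) - u (x + 0 *\<^sub>R e)) /\<^sub>R inverse (real (Suc n))) \<le> L"
    using lipschitz_difference_quotient_le[OF assms(1,2), of "inverse (real (Suc n))" x for n]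
    by (simp only: scaleR_zero_left add_0_right) simp
qed

text \<open>The derivative is an almost everywhere limit of continuous difference quotients. The
  values of \<open>v\<close> on the exceptional set are unconstrained, which the completeness of
  Lebesgue measure permits.\<close>

lemma directional_derivative_measurable:
  fixes u :: "'a::euclidean_space \<Rightarrow> 'b::euclidean_space"
  assumes u: "continuous_on UNIV u"
    and D: "AE x in lebesgue. ((\<lambda>t. u (x + t *\<^sub>R e)) has_vector_derivative v x) (at 0)"
  shows "v \<in> borel_measurable lebesgue"
proof -
  define q where "q n x = (u (x + inverse (real (Suc n)) *\<^sub>R e) - u x) /\<^sub>R inverse (real (Suc n))" for n x
  have "continuous_on UNIV (q n)" for n
    unfolding q_def[abs_def]
    by (intro continuous_intros continuous_on_compose2[OF u]) auto
  then have "q n \<in> borel_measurable lebesgue" for n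
    by (rule borel_measurable_lebesgue_continuous)
  then have "(\<lambda>x. lim (\<lambda>n. q n x)) \<in> borel_measurable lebesgue"
    by (rule borel_measurable_lim_metric)
  moreover have "AE x in lebesgue. lim (\<lambda>n. q n x) = v x"
    using D
  proof eventually_elim
    case (elim x)
    have "(\<lambda>n. q n x) \<longlonglongrightarrow> v x"
      using has_vector_derivative_quotient_tendsto[OF elim LIMSEQ_inverse_real_of_nat]
      by (simp add: q_def)
    then show ?case by (rule limI)
  qed
  ultimately show ?thesis by (rule borel_measurable_AE)
qed

lemma locally_integrable_bounded:
  fixes v :: "real^'n::finite \<Rightarrow> 'b::euclidean_space"
  assumes "v \<in> borel_measurable lebesgue" "AE x in lebesgue. norm (v x) \<le> B"
  shows "locally_integrable v"
  unfolding locally_integrable_def set_integrable_def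
proof (intro allI impI)
  fix K :: "(real^'n) set" assume K: "compact K"
  then have K': "K \<in> sets lebesgue" "emeasure lebesgue K < \<infinity>"
    using emeasure_compact_finite[OF K] by (auto simp: compact_imp_closed)
  show "integrable lebesgue (\<lambda>x. indicat_real K x *\<^sub>R v x)"
  proof (rule Bochner_Integration.integrable_bound)
    show "integrable lebesgue (\<lambda>x. B * indicat_real K x)"
      using K' by (intro integrable_mult_right integrable_real_indicator)
    show "(\<lambda>x. indicat_real K x *\<^sub>R v x) \<in> borel_measurable lebesgue"
      using K' by (intro borel_measurable_scaleR assms) auto
    show "AE x in lebesgue. norm (indicat_real K x *\<^sub>R v x) \<le> norm (B * indicat_real K x)"
      using assms(2) by eventually_elim (auto simp: indicator_def)
  qed
qed

lemma locally_integrable_continuous: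
  fixes u :: "real^'n::finite \<Rightarrow> 'b::euclidean_space"
  assumes "continuous_on UNIV u"
  shows "locally_integrable u"
  unfolding locally_integrable_def set_integrable_def
proof (intro allI impI)
  fix K :: "(real^'n) set" assume K: "compact K"
  have "integrable lborel (\<lambda>x. indicat_real K x *\<^sub>R u x)"
    using assms by (intro borel_integrable_compact K) (auto intro: continuous_on_subset)
  then show "integrable lebesgue (\<lambda>x. indicat_real K x *\<^sub>R u x)"
    by (subst integrable_completion) auto
qed

lemma test_function_partial:
  assumes "test_function \<phi>"
  shows "continuous_on UNIV (partial i \<phi>)"
    and "((\<lambda>t. \<phi> (x + t *\<^sub>R axis i 1)) has_real_derivative partial i \<phi> (x + t *\<^sub>R axis i 1)) (at t)"
proof -
  have "Ck (Suc 0) \<phi>" using assms by (auto simp: test_function_def)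
  then show "continuous_on UNIV (partial i \<phi>)" by simp
  have "(\<phi> has_derivative frechet_derivative \<phi> (at y)) (at y)" for y
    using \<open>Ck (Suc 0) \<phi>\<close> by (simp add: frechet_derivative_works[symmetric])
  then have "((\<lambda>t. \<phi> (x + t *\<^sub>R axis i 1)) has_derivative
      (\<lambda>s. frechet_derivative \<phi> (at (x + t *\<^sub>R axis i 1)) (s *\<^sub>R axis i 1))) (at t)"
    by (intro has_derivative_compose[where g=\<phi> and f="\<lambda>t. x + t *\<^sub>R axis i 1"])
       (auto intro!: derivative_eq_intros)
  moreover have "linear (frechet_derivative \<phi> (at y))" for y
    using \<open>Ck (Suc 0) \<phi>\<close> by (simp add: linear_frechet_derivative)
  then have "(\<lambda>s. frechet_derivative \<phi> (at (x + t *\<^sub>R axis i 1)) (s *\<^sub>R axis i 1)) =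
      (*) (partial i \<phi> (x + t *\<^sub>R axis i 1))"
    by (simp add: fun_eq_iff linear_scale partial_def)
  ultimately show "((\<lambda>t. \<phi> (x + t *\<^sub>R axis i 1)) has_real_derivative
      partial i \<phi> (x + t *\<^sub>R axis i 1)) (at t)"
    by (simp add: has_field_derivative_def)
qed

text \<open>Integration by parts is moved to the difference quotients, where it is translation
  invariance of Lebesgue measure; dominated convergence then passes to the limit.\<close>

lemma has_weak_partial_lipschitz:
  fixes u :: "real^'n::finite \<Rightarrow> 'b::euclidean_space"
  assumes L: "L-lipschitz_on UNIV u"
    and D: "AE x in lebesgue. ((\<lambda>t. u (x + t *\<^sub>R axis i 1)) has_vector_derivative v x) (at 0)"
  shows "has_weak_partial i u v"
proof -
  define e :: "real^'n" where "e = axis i 1"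
  have e: "norm e = 1" by (simp add: e_def norm_axis_1)
  have u: "continuous_on UNIV u"
    using L by (rule lipschitz_on_continuous_on)
  have v: "v \<in> borel_measurable lebesgue"
    by (rule directional_derivative_measurable[OF u D])
  have "AE x in lebesgue. norm (v x) \<le> L"
    using D by eventually_elim (rule lipschitz_directional_derivative_le[OF L e[unfolded e_def]])
  then have loc: "locally_integrable u" "locally_integrable v"
    using locally_integrable_continuous[OF u] locally_integrable_bounded[OF v] by auto
  moreover have "(LINT x|lebesgue. partial i \<phi> x *\<^sub>R u x) = - (LINT x|lebesgue. \<phi> x *\<^sub>R v x)"
    if \<phi>: "test_function \<phi>" for \<phi>
  proof -
    define h where "h n = inverse (real (Suc n))" for n
    have h: "0 < h n" "h n \<le> 1" for n
      by (auto simp: h_def field_simps)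
    have hn0: "h n \<noteq> 0" for n
      by (simp add: h_def)
    have h0: "h \<longlonglongrightarrow> 0"
      unfolding h_def[abs_def] by (rule LIMSEQ_inverse_real_of_nat)
    have \<phi>c: "continuous_on UNIV \<phi>" by (rule test_function_continuous[OF \<phi>])
    obtain K where K: "compact K" "\<And>x. x \<notin> K \<Longrightarrow> \<phi> x = 0"
      by (rule test_function_support[OF \<phi>]) auto
    obtain R where R: "\<forall>x\<in>K. norm x \<le> R"
      using compact_imp_bounded[OF K(1)] unfolding bounded_iff ..
    have supp: "\<phi> x = 0" if "norm x > R" for x
      using that R K(2)[of x] by force
    have supp': "partial i \<phi> x = 0" if x: "norm x > R" for x
    proof -
      have "\<phi> differentiable (at x)"
        using \<phi> unfolding test_function_def by (metis Ck.simps(2))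
      then have "(\<phi> has_derivative frechet_derivative \<phi> (at x)) (at x)"
        by (simp add: frechet_derivative_works)
      moreover have "((\<lambda>_. 0) has_derivative (\<lambda>_. 0)) (at x)" by simp
      then have "(\<phi> has_derivative (\<lambda>_. 0)) (at x)"
        by (rule has_derivative_transform_within_open[where s="- cball 0 R"])
           (use x supp in auto)
      ultimately have "frechet_derivative \<phi> (at x) = (\<lambda>_. 0)"
        by (rule has_derivative_unique)
      then show ?thesis by (simp add: partial_def)
    qed
    obtain C where C: "0 \<le> C" "\<And>x. norm (partial i \<phi> x) \<le> C"
      by (rule bounded_continuous_compact_support[OF test_function_partial(1)[OF \<phi>], of "cball 0 R"])
         (use supp' in auto)
    \<comment> \<open>The mean value theorem bounds the quotient by the supremum of the partial
      derivative. Since \<open>h n\<close> is at most 1, all quotients vanish outside the ball of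
      radius R + 1, so one dominating function serves every n.\<close>
    have quot: "\<bar>(\<phi> (x + h n *\<^sub>R e) - \<phi> x) / h n\<bar> \<le> C * indicat_real (cball 0 (R + 1)) x" for n x
    proof (cases "norm x \<le> R + 1")
      case True
      obtain z where "\<phi> (x + h n *\<^sub>R e) - \<phi> (x + 0 *\<^sub>R e) = (h n - 0) * partial i \<phi> (x + z *\<^sub>R e)"
        using MVT2[of 0 "h n" "\<lambda>t. \<phi> (x + t *\<^sub>R e)" "\<lambda>t. partial i \<phi> (x + t *\<^sub>R e)"]
          test_function_partial(2)[OF \<phi>] h(1)[of n] unfolding e_def by blast
      then have "(\<phi> (x + h n *\<^sub>R e) - \<phi> x) / h n = partial i \<phi> (x + z *\<^sub>R e)"
        using h(1)[of n] by (simp add: field_simps)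
      then show ?thesis using C(2)[of "x + z *\<^sub>R e"] True by (simp del: divide_const_simps)
    next
      case False
      moreover have "norm x \<le> norm (x + h n *\<^sub>R e) + h n"
        using norm_triangle_ineq4[of "x + h n *\<^sub>R e" "h n *\<^sub>R e"] e h(1)[of n] by simp
      ultimately show ?thesis
        using supp[of x] supp[of "x + h n *\<^sub>R e"] h(2)[of n] by simp
    qed
    have shift: "continuous_on UNIV (\<lambda>x. \<phi> (x + h n *\<^sub>R e))" for n
      by (intro continuous_on_compose2[OF \<phi>c] continuous_intros) auto
    have \<phi>u: "integrable lebesgue (\<lambda>x. \<phi> x *\<^sub>R u x)"
      by (rule integrable_test_function_scaleR[OF \<phi> loc(1)])
    have \<phi>v: "integrable lebesgue (\<lambda>x. \<phi> x *\<^sub>R v x)"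
      by (rule integrable_test_function_scaleR[OF \<phi> loc(2)])
    have \<phi>hu: "integrable lebesgue (\<lambda>x. \<phi> (x + h n *\<^sub>R e) *\<^sub>R u x)" for n
    proof (rule integrable_scaleR_locally_integrable[OF shift _ _ loc(1)])
      show "\<phi> (x + h n *\<^sub>R e) = 0" if "x \<notin> cball 0 (R + 1)" for x
      proof -
        have "norm x \<le> norm (x + h n *\<^sub>R e) + h n"
          using norm_triangle_ineq4[of "x + h n *\<^sub>R e" "h n *\<^sub>R e"] e h(1)[of n] by simp
        then show ?thesis using that h(2)[of n] by (intro supp) simp
      qed
    qed simp
    have u_shift: "continuous_on UNIV (\<lambda>x. u (x + (- h n) *\<^sub>R e))" for n
      by (intro continuous_on_compose2[OF u] continuous_intros) auto
    have \<phi>uh: "integrable lebesgue (\<lambda>x. \<phi> x *\<^sub>R u (x + (- h n) *\<^sub>R e))" for n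
      by (rule integrable_test_function_scaleR[OF \<phi> locally_integrable_continuous[OF u_shift]])
    \<comment> \<open>Discrete integration by parts: translating the term with
      \<open>\<phi> (x + h n *\<^sub>R e)\<close> moves the increment onto \<open>u\<close>, now
      with step \<open>- h n\<close>.\<close>
    have parts: "(LINT x|lebesgue. ((\<phi> (x + h n *\<^sub>R e) - \<phi> x) / h n) *\<^sub>R u x) =
        - (LINT x|lebesgue. \<phi> x *\<^sub>R ((u (x + (- h n) *\<^sub>R e) - u x) /\<^sub>R (- h n)))" for n
    proof -
      have "(LINT x|lebesgue. \<phi> (x + h n *\<^sub>R e) *\<^sub>R u x) =
          (LINT x|lebesgue. \<phi> (h n *\<^sub>R e + x) *\<^sub>R u ((h n *\<^sub>R e + x) + (- h n) *\<^sub>R e))"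
        by (simp add: add.commute)
      also have "\<dots> = (LINT x|lebesgue. \<phi> x *\<^sub>R u (x + (- h n) *\<^sub>R e))"
        by (rule lebesgue_integral_translation[where f="\<lambda>x. \<phi> x *\<^sub>R u (x + (- h n) *\<^sub>R e)"])
           (rule borel_measurable_integrable[OF \<phi>uh])
      finally have eq: "(LINT x|lebesgue. \<phi> (x + h n *\<^sub>R e) *\<^sub>R u x) =
          (LINT x|lebesgue. \<phi> x *\<^sub>R u (x + (- h n) *\<^sub>R e))" .
      have "(LINT x|lebesgue. ((\<phi> (x + h n *\<^sub>R e) - \<phi> x) / h n) *\<^sub>R u x) =
          (LINT x|lebesgue. inverse (h n) *\<^sub>R (\<phi> (x + h n *\<^sub>R e) *\<^sub>R u x - \<phi> x *\<^sub>R u x))"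
        by (simp add: divide_inverse scaleR_diff_left scaleR_diff_right mult.commute algebra_simps)
      also have "\<dots> = inverse (h n) *\<^sub>R ((LINT x|lebesgue. \<phi> (x + h n *\<^sub>R e) *\<^sub>R u x) - (LINT x|lebesgue. \<phi> x *\<^sub>R u x))"
        by (simp only: integral_scaleR_right Bochner_Integration.integral_diff[OF \<phi>hu \<phi>u])
      also have "\<dots> = inverse (h n) *\<^sub>R ((LINT x|lebesgue. \<phi> x *\<^sub>R u (x + (- h n) *\<^sub>R e)) - (LINT x|lebesgue. \<phi> x *\<^sub>R u x))"
        unfolding eq ..
      also have "\<dots> = (LINT x|lebesgue. inverse (h n) *\<^sub>R (\<phi> x *\<^sub>R u (x + (- h n) *\<^sub>R e) - \<phi> x *\<^sub>R u x))"
        by (simp only: integral_scaleR_right Bochner_Integration.integral_diff[OF \<phi>uh \<phi>u])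
      also have "\<dots> = - (LINT x|lebesgue. \<phi> x *\<^sub>R ((u (x + (- h n) *\<^sub>R e) - u x) /\<^sub>R (- h n)))"
        by (simp add: scaleR_diff_right algebra_simps flip: Bochner_Integration.integral_minus)
      finally show ?thesis .
    qed
    have lim1: "(\<lambda>n. LINT x|lebesgue. ((\<phi> (x + h n *\<^sub>R e) - \<phi> x) / h n) *\<^sub>R u x)
        \<longlonglongrightarrow> (LINT x|lebesgue. partial i \<phi> x *\<^sub>R u x)"
    proof (rule integral_dominated_convergence)
      show "(\<lambda>x. partial i \<phi> x *\<^sub>R u x) \<in> borel_measurable lebesgue"
        using test_function_partial(1)[OF \<phi>] u by (intro borel_measurable_lebesgue_continuous continuous_intros)
      show "(\<lambda>x. ((\<phi> (x + h n *\<^sub>R e) - \<phi> x) / h n) *\<^sub>R u x) \<in> borel_measurable lebesgue" for n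
        using u shift \<phi>c h(1)[of n]
        by (intro borel_measurable_lebesgue_continuous continuous_intros) auto
      have "integrable lebesgue (\<lambda>x. indicat_real (cball 0 (R + 1)) x *\<^sub>R u x)"
        using loc(1) by (simp add: locally_integrable_def set_integrable_def)
      then show "integrable lebesgue (\<lambda>x. C * norm (indicat_real (cball 0 (R + 1)) x *\<^sub>R u x))"
        by (intro integrable_mult_right integrable_norm)
      show "AE x in lebesgue. (\<lambda>n. ((\<phi> (x + h n *\<^sub>R e) - \<phi> x) / h n) *\<^sub>R u x) \<longlonglongrightarrow> partial i \<phi> x *\<^sub>R u x"
      proof (intro always_eventually allI tendsto_scaleR tendsto_const)
        fix x
        have "((\<lambda>t. \<phi> (x + t *\<^sub>R e)) has_vector_derivative partial i \<phi> x) (at 0)"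
          using test_function_partial(2)[OF \<phi>, of x i 0]
          by (simp add: e_def has_real_derivative_iff_has_vector_derivative)
        from has_vector_derivative_quotient_tendsto[OF this h0 hn0]
        show "(\<lambda>n. (\<phi> (x + h n *\<^sub>R e) - \<phi> x) / h n) \<longlonglongrightarrow> partial i \<phi> x"
          by (simp add: divide_inverse_commute)
      qed
      show "AE x in lebesgue. norm (((\<phi> (x + h n *\<^sub>R e) - \<phi> x) / h n) *\<^sub>R u x)
          \<le> C * norm (indicat_real (cball 0 (R + 1)) x *\<^sub>R u x)" for n
      proof (intro always_eventually allI)
        fix x
        show "norm (((\<phi> (x + h n *\<^sub>R e) - \<phi> x) / h n) *\<^sub>R u x)
          \<le> C * norm (indicat_real (cball 0 (R + 1)) x *\<^sub>R u x)"
          using mult_right_mono[OF quot[of x n] norm_ge_zero[of "u x"]] by (simp add: mult.assoc)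
      qed
    qed
    \<comment> \<open>The derivative \<open>v x\<close> is two-sided, so quotients with negative
      steps converge to it as well; the Lipschitz constant supplies the dominating function L
      |phi|.\<close>
    have lim2: "(\<lambda>n. LINT x|lebesgue. \<phi> x *\<^sub>R ((u (x + (- h n) *\<^sub>R e) - u x) /\<^sub>R (- h n)))
        \<longlonglongrightarrow> (LINT x|lebesgue. \<phi> x *\<^sub>R v x)"
    proof (rule integral_dominated_convergence)
      show "(\<lambda>x. \<phi> x *\<^sub>R v x) \<in> borel_measurable lebesgue"
        using \<phi>v by (rule borel_measurable_integrable)
      show "(\<lambda>x. \<phi> x *\<^sub>R ((u (x + (- h n) *\<^sub>R e) - u x) /\<^sub>R (- h n))) \<in> borel_measurable lebesgue" for n
        using u u_shift \<phi>c by (intro borel_measurable_lebesgue_continuous continuous_intros)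
      have "integrable lebesgue (\<lambda>x. \<phi> x *\<^sub>R (1::real))"
        by (rule integrable_test_function_scaleR[OF \<phi> locally_integrable_continuous]) simp
      then show "integrable lebesgue (\<lambda>x. norm (\<phi> x) * L)"
        by (intro integrable_mult_left integrable_norm) simp
      show "AE x in lebesgue. (\<lambda>n. \<phi> x *\<^sub>R ((u (x + (- h n) *\<^sub>R e) - u x) /\<^sub>R (- h n))) \<longlonglongrightarrow> \<phi> x *\<^sub>R v x"
        using D
      proof eventually_elim
        case (elim x)
        have "(\<lambda>n. (u (x + (- h n) *\<^sub>R e) - u (x + 0 *\<^sub>R e)) /\<^sub>R (- h n)) \<longlonglongrightarrow> v x"
          using elim tendsto_minus[OF h0] hn0 unfolding e_def
          by (intro has_vector_derivative_quotient_tendsto) auto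
        then show ?case by (intro tendsto_intros) simp
      qed
      show "AE x in lebesgue. norm (\<phi> x *\<^sub>R ((u (x + (- h n) *\<^sub>R e) - u x) /\<^sub>R (- h n))) \<le> norm (\<phi> x) * L" for n
      proof (intro always_eventually allI)
        fix x
        show "norm (\<phi> x *\<^sub>R ((u (x + (- h n) *\<^sub>R e) - u x) /\<^sub>R (- h n))) \<le> norm (\<phi> x) * L"
          unfolding norm_scaleR[of "\<phi> x"] real_norm_def
          by (intro mult_left_mono lipschitz_difference_quotient_le[OF L e]) (use hn0 in auto)
      qed
    qed
    show ?thesis
      using LIMSEQ_unique[OF lim1] tendsto_minus[OF lim2] by (simp only: parts)
  qed
  ultimately show ?thesis by (simp add: has_weak_partial_def)
qed

section \<open>Sobolev membership from Lipschitz bounds and bounded support\<close>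

lemma L2_bounded_support:
  fixes u :: "real^'n::finite \<Rightarrow> 'b::euclidean_space"
  assumes u: "u \<in> borel_measurable lebesgue"
    and B: "AE x in lebesgue. norm (u x) \<le> B" and R: "AE x in lebesgue. R < norm x \<longrightarrow> u x = 0"
  shows "u \<in> L2"
proof -
  have "integrable lebesgue (\<lambda>x. (norm (u x))\<^sup>2)"
  proof (rule Bochner_Integration.integrable_bound)
    show "integrable lebesgue (\<lambda>x. B\<^sup>2 * indicat_real (cball (0::real^'n) R) x)"
      using emeasure_lborel_cball_finite[of "0::real^'n" R]
      by (intro integrable_mult_right integrable_real_indicator) auto
    show "(\<lambda>x. (norm (u x))\<^sup>2) \<in> borel_measurable lebesgue"
      by (intro borel_measurable_power measurable_compose[OF u borel_measurable_norm])
    show "AE x in lebesgue. norm ((norm (u x))\<^sup>2) \<le> norm (B\<^sup>2 * indicat_real (cball 0 R) x)"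
      using B R by eventually_elim (auto simp: indicator_def not_le intro!: power_mono)
  qed
  then show ?thesis using u by (simp add: L2_def)
qed

text \<open>The Lipschitz constant bounds the derivative, and constancy of \<open>u\<close> outside
  a ball makes it vanish there.\<close>

lemma weak_partial_lipschitz_support:
  fixes u :: "real^'n::finite \<Rightarrow> 'b::euclidean_space"
  assumes L: "L-lipschitz_on UNIV u"
    and R: "\<And>x. R < norm x \<Longrightarrow> u x = c"
    and D: "AE x in lebesgue. ((\<lambda>t. u (x + t *\<^sub>R axis i 1)) has_vector_derivative v x) (at 0)"
  shows "v \<in> L2"
proof (rule L2_bounded_support)
  have u: "continuous_on UNIV u"
    using L by (rule lipschitz_on_continuous_on)
  show "v \<in> borel_measurable lebesgue"
    by (rule directional_derivative_measurable[OF u D])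
  show "AE x in lebesgue. norm (v x) \<le> L"
    using D by eventually_elim (rule lipschitz_directional_derivative_le[OF L], simp_all add: norm_axis_1)
  show "AE x in lebesgue. R < norm x \<longrightarrow> v x = 0"
    using D
  proof eventually_elim
    case (elim x)
    show ?case
    proof
      assume x: "R < norm x"
      have "((\<lambda>_. c) has_vector_derivative 0) (at (0::real))" by simp
      then have "((\<lambda>t. u (x + t *\<^sub>R axis i 1)) has_vector_derivative 0) (at 0)"
      proof (rule has_vector_derivative_transform_within_open[where S="{t. R < norm (x + t *\<^sub>R axis i 1)}"])
        show "open {t. R < norm (x + t *\<^sub>R axis i 1)}"
          by (intro open_Collect_less continuous_intros)
      qed (use x R in auto)
      then show "v x = 0"
        using elim vector_derivative_unique_at by blast
    qed
  qed
qed

lemma H1_lipschitz_support: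
  fixes u :: "real^'n::finite \<Rightarrow> 'b::euclidean_space"
  assumes L: "L-lipschitz_on UNIV u"
    and R: "\<And>x. R < norm x \<Longrightarrow> u x = 0"
    and D: "\<And>i. AE x in lebesgue. ((\<lambda>t. u (x + t *\<^sub>R axis i 1)) has_vector_derivative v i x) (at 0)"
  shows "u \<in> H1"
proof -
  have u: "continuous_on UNIV u"
    using L by (rule lipschitz_on_continuous_on)
  have supp: "u x = 0" if "x \<notin> cball 0 R" for x
    using that R by auto
  obtain B where "\<And>x. norm (u x) \<le> B"
    using bounded_continuous_compact_support[OF u compact_cball[of 0 R] supp] by blast
  then have "u \<in> L2"
    using borel_measurable_lebesgue_continuous[OF u] R by (intro L2_bounded_support) auto
  then show ?thesis
    using has_weak_partial_lipschitz[OF L D] weak_partial_lipschitz_support[OF L R D]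
    unfolding H1_def by blast
qed

section \<open>Integrals of radial functions\<close>

text \<open>Polar coordinates without an angle: the disc area pi a^2 is the distribution function of
  the norm, and its derivative 2 pi r is the density. Half-lines generate the Borel sets of the
  line, so they suffice for the comparison; \<open>max 0 r\<close> gives negative radii no
  mass.\<close>

lemma distr_norm_lborel:
  "distr lborel borel (norm :: real^2 \<Rightarrow> real) = density lborel (\<lambda>r. ennreal (2 * pi * max 0 r))"
proof (rule measure_eqI_generator_eq[where E="range atMost" and \<Omega>=UNIV and A="\<lambda>n. {..real n}"])
  have L: "emeasure (distr lborel borel (norm :: real^2 \<Rightarrow> real)) {..a} = ennreal (pi * (max 0 a)\<^sup>2)" for a
  proof -
    have "emeasure (distr lborel borel (norm :: real^2 \<Rightarrow> real)) {..a} = emeasure lborel (cball (0::real^2) a)"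
      by (subst emeasure_distr) (auto intro!: arg_cong[where f="emeasure lborel"])
    also have "\<dots> = ennreal (pi * (max 0 a)\<^sup>2)"
      by (cases "0 \<le> a") (auto simp: emeasure_cball unit_ball_vol_2 max_def)
    finally show ?thesis .
  qed
  fix X :: "real set" assume "X \<in> range atMost"
  then obtain a where X: "X = {..a}" by auto
  have "emeasure (density lborel (\<lambda>r. ennreal (2 * pi * max 0 r))) {..a} =
      (\<integral>\<^sup>+ r. ennreal (2 * pi * r) * indicator {0..max 0 a} r \<partial>lborel)"
    by (subst emeasure_density) (auto intro!: nn_integral_cong simp: indicator_def max_def)
  also have "\<dots> = ennreal (pi * (max 0 a)\<^sup>2 - pi * 0\<^sup>2)"
    by (rule nn_integral_FTC_Icc) (auto intro!: derivative_eq_intros)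
  finally show "emeasure (distr lborel borel (norm :: real^2 \<Rightarrow> real)) X =
      emeasure (density lborel (\<lambda>r. ennreal (2 * pi * max 0 r))) X"
    unfolding X L by simp
next
  show "emeasure (distr lborel borel (norm :: real^2 \<Rightarrow> real)) {..real n} \<noteq> \<infinity>" for n
  proof -
    have "emeasure (distr lborel borel (norm :: real^2 \<Rightarrow> real)) {..real n} = emeasure lborel (cball (0::real^2) n)"
      by (subst emeasure_distr) (auto intro!: arg_cong[where f="emeasure lborel"])
    then show ?thesis
      using emeasure_lborel_cball_finite[of "0::real^2" "real n"] by simp
  qed
qed (auto simp: Int_stable_def borel_eq_atMost real_arch_simple)

lemma has_bochner_integral_radial:
  fixes g :: "real \<Rightarrow> real"
  assumes [measurable]: "g \<in> borel_measurable borel"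
    and I: "has_bochner_integral lborel (\<lambda>r. 2 * pi * max 0 r * g r) I"
  shows "has_bochner_integral lebesgue (\<lambda>x::real^2. g (norm x)) I"
proof -
  have "has_bochner_integral (density lborel (\<lambda>r. ennreal (2 * pi * max 0 r))) g I"
    using I by (intro has_bochner_integral_density) auto
  then have "has_bochner_integral (distr lborel borel (norm :: real^2 \<Rightarrow> real)) g I"
    by (simp add: distr_norm_lborel)
  then have "has_bochner_integral lborel (\<lambda>x::real^2. g (norm x)) I"
    by (auto simp: has_bochner_integral_iff integrable_distr_eq integral_distr)
  then show ?thesis
    by (auto simp: has_bochner_integral_iff integrable_completion integral_completion)
qed

section \<open>Lipschitz functions in polar form\<close>

lemma lipschitz_on_mult_real:
  fixes f g :: "'a::metric_space \<Rightarrow> real"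
  assumes f: "L-lipschitz_on X f" and g: "M-lipschitz_on X g"
    and F: "\<And>x. x \<in> X \<Longrightarrow> \<bar>f x\<bar> \<le> F" and G: "\<And>x. x \<in> X \<Longrightarrow> \<bar>g x\<bar> \<le> G"
    and nonneg: "0 \<le> F" "0 \<le> G"
  shows "(F * M + G * L)-lipschitz_on X (\<lambda>x. f x * g x)"
proof (rule lipschitz_onI)
  show "0 \<le> F * M + G * L"
    using nonneg lipschitz_on_nonneg[OF f] lipschitz_on_nonneg[OF g] by simp
  fix x y assume xy: "x \<in> X" "y \<in> X"
  have "f x * g x - f y * g y = f x * (g x - g y) + g y * (f x - f y)"
    by (simp add: algebra_simps)
  then have "\<bar>f x * g x - f y * g y\<bar> \<le> \<bar>f x\<bar> * \<bar>g x - g y\<bar> + \<bar>g y\<bar> * \<bar>f x - f y\<bar>"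
    by (metis abs_mult abs_triangle_ineq)
  also have "\<dots> \<le> F * (M * dist x y) + G * (L * dist x y)"
    using lipschitz_onD[OF f xy] lipschitz_onD[OF g xy] F[OF xy(1)] G[OF xy(2)] nonneg
    by (intro add_mono mult_mono) (auto simp: dist_real_def)
  finally show "dist (f x * g x) (f y * g y) \<le> (F * M + G * L) * dist x y"
    by (simp add: dist_real_def algebra_simps)
qed

text \<open>\<open>\<sigma> t / t\<close> is the average of \<open>\<sigma>'\<close> over \<open>{0..t}\<close>.\<close>

lemma lipschitz_on_slope:
  fixes \<sigma> \<sigma>' :: "real \<Rightarrow> real"
  assumes D: "\<And>t. (\<sigma> has_real_derivative \<sigma>' t) (at t)"
    and L: "L-lipschitz_on {0..} \<sigma>'" and "\<sigma> 0 = 0"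
  shows "L-lipschitz_on {0..} (\<lambda>t. if t = 0 then \<sigma>' 0 else \<sigma> t / t)"
proof (rule lipschitz_onI)
  show "0 \<le> L" using L by (rule lipschitz_on_nonneg)
  fix s t :: real assume st: "s \<in> {0..}" "t \<in> {0..}"
  \<comment> \<open>\<open>q t 1\<close> is the slope and \<open>q t 0\<close> vanishes. The mean
    value theorem for \<open>q s - q t\<close> in the variable u then plays the role of averaging
    the derivative over the interval.\<close>
  define q where "q t u = (if t = 0 then \<sigma>' 0 * u else \<sigma> (t * u) / t)" for t u
  have q: "(q t has_real_derivative \<sigma>' (t * u)) (at u)" for t u
  proof (cases "t = 0")
    case False
    have "((\<lambda>u. \<sigma> (t * u) / t) has_real_derivative \<sigma>' (t * u) * t / t) (at u)"
      by (intro DERIV_cdivide DERIV_chain2[OF D]) (auto intro!: derivative_eq_intros)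
    then show ?thesis using False by (simp add: q_def[abs_def])
  qed (auto simp: q_def[abs_def] intro!: derivative_eq_intros)
  have "((\<lambda>u. q s u - q t u) has_real_derivative \<sigma>' (s * u) - \<sigma>' (t * u)) (at u)" for u
    by (intro DERIV_diff q)
  then obtain z where z: "0 < z" "z < 1"
      "(q s 1 - q t 1) - (q s 0 - q t 0) = (1 - 0) * (\<sigma>' (s * z) - \<sigma>' (t * z))"
    using MVT2[of 0 1 "\<lambda>u. q s u - q t u" "\<lambda>u. \<sigma>' (s * u) - \<sigma>' (t * u)"] by auto
  have q0: "q t 0 = 0" for t
    using \<open>\<sigma> 0 = 0\<close> by (simp add: q_def)
  have "dist (q s 1) (q t 1) = dist (\<sigma>' (s * z)) (\<sigma>' (t * z))"
    using z(3) by (simp add: dist_real_def q0)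
  also have "\<dots> \<le> L * dist (s * z) (t * z)"
    using st z by (intro lipschitz_onD[OF L]) auto
  also have "dist (s * z) (t * z) = dist s t * z"
    using z by (simp add: dist_real_def abs_mult flip: left_diff_distrib)
  also have "L * (dist s t * z) \<le> L * dist s t"
    using z \<open>0 \<le> L\<close> by (intro mult_left_mono) (auto simp: mult_left_le)
  finally show "dist (if s = 0 then \<sigma>' 0 else \<sigma> s / s) (if t = 0 then \<sigma>' 0 else \<sigma> t / t) \<le> L * dist s t"
    unfolding q_def by (simp only: mult_1_right)
qed

lemma lipschitz_on_norm_comp:
  fixes h :: "real \<Rightarrow> real"
  assumes h: "L-lipschitz_on {0..} h"
  shows "L-lipschitz_on UNIV (\<lambda>x::'a::real_normed_vector. h (norm x))"
proof (rule lipschitz_onI)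
  show "0 \<le> L" using h by (rule lipschitz_on_nonneg)
  fix x y :: 'a
  have "dist (h (norm x)) (h (norm y)) \<le> L * dist (norm x) (norm y)"
    by (rule lipschitz_onD[OF h]) auto
  also have "\<dots> \<le> L * dist x y"
    using \<open>0 \<le> L\<close> by (intro mult_left_mono) (auto simp: dist_norm norm_triangle_ineq3)
  finally show "dist (h (norm x)) (h (norm y)) \<le> L * dist x y" .
qed

text \<open>A bounded angular factor may be discontinuous at the origin, where the radial factor vanishes.\<close>

lemma lipschitz_on_angular:
  fixes h :: "real \<Rightarrow> real" and e :: "'a::real_normed_vector \<Rightarrow> real"
  assumes h: "L-lipschitz_on {0..} h" "h 0 = 0"
    and e: "\<And>x. \<bar>e x\<bar> \<le> 1" "\<And>x y. norm y \<le> norm x \<Longrightarrow> \<bar>e x - e y\<bar> * norm y \<le> M * dist x y"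
    and M: "0 \<le> M"
  shows "(L + L * M)-lipschitz_on UNIV (\<lambda>x. e x * h (norm x))"
proof (rule lipschitz_onI)
  have L: "0 \<le> L" using h(1) by (rule lipschitz_on_nonneg)
  then show "0 \<le> L + L * M" using M by simp
  \<comment> \<open>With the norms ordered, the increment of \<open>e\<close> is multiplied by
    \<open>h\<close> at the smaller radius, which is exactly the product controlled by the
    hypothesis. The other order follows by symmetry.\<close>
  have *: "\<bar>e x * h (norm x) - e y * h (norm y)\<bar> \<le> (L + L * M) * dist x y" if xy: "norm y \<le> norm x" for x y
  proof -
    have "e x * h (norm x) - e y * h (norm y) = e x * (h (norm x) - h (norm y)) + h (norm y) * (e x - e y)"
      by (simp add: algebra_simps)
    then have "\<bar>e x * h (norm x) - e y * h (norm y)\<bar>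
        \<le> \<bar>e x\<bar> * \<bar>h (norm x) - h (norm y)\<bar> + \<bar>h (norm y)\<bar> * \<bar>e x - e y\<bar>"
      by (metis abs_mult abs_triangle_ineq)
    also have "\<dots> \<le> 1 * (L * dist x y) + (L * norm y) * \<bar>e x - e y\<bar>"
    proof (intro add_mono mult_mono)
      show "\<bar>h (norm x) - h (norm y)\<bar> \<le> L * dist x y"
        using lipschitz_onD[OF lipschitz_on_norm_comp[OF h(1)], of x y] by (simp add: dist_real_def)
      show "\<bar>h (norm y)\<bar> \<le> L * norm y"
        using lipschitz_onD[OF h(1), of "norm y" 0] h(2) by (simp add: dist_real_def)
    qed (use e L in auto)
    also have "\<dots> \<le> L * dist x y + L * (M * dist x y)"
      using mult_left_mono[OF e(2)[OF xy] L] by (simp add: mult_ac)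
    finally show ?thesis by (simp add: algebra_simps)
  qed
  fix x y
  show "dist (e x * h (norm x)) (e y * h (norm y)) \<le> (L + L * M) * dist x y"
    using *[of x y] *[of y x] by (cases "norm y \<le> norm x") (auto simp: dist_real_def dist_commute abs_minus_commute)
qed

definition unit_comp :: "'n::finite \<Rightarrow> real^'n \<Rightarrow> real" where
  "unit_comp i x = x $ i / norm x"

lemma abs_unit_comp_le_1: "\<bar>unit_comp i x\<bar> \<le> 1"
  using component_le_norm_cart[of x i] by (cases "x = 0") (auto simp: unit_comp_def divide_le_eq)

text \<open>The direction x/|x| varies at rate 1/|x|, so weighting by the smaller norm removes the
  singularity. The two summands, a change of norm and a change of coordinate, contribute one
  \<open>dist x y\<close> each.\<close>

lemma unit_comp_difference:
  assumes "norm y \<le> norm x"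
  shows "\<bar>unit_comp i x - unit_comp i y\<bar> * norm y \<le> 2 * dist x y"
proof (cases "y = 0")
  case False
  with assms have x: "norm x > 0" and y: "norm y > 0"
    by (auto intro: less_le_trans)
  have "(unit_comp i x - unit_comp i y) * norm y = unit_comp i x * (norm y - norm x) + (x $ i - y $ i)"
    using x y by (simp add: unit_comp_def field_simps)
  then have "\<bar>unit_comp i x - unit_comp i y\<bar> * norm y \<le> \<bar>unit_comp i x\<bar> * \<bar>norm y - norm x\<bar> + \<bar>x $ i - y $ i\<bar>"
    by (metis abs_mult abs_norm_cancel abs_triangle_ineq)
  also have "\<dots> \<le> 1 * dist x y + dist x y"
    using norm_triangle_ineq3[of y x] component_le_norm_cart[of "x - y" i]
    by (intro add_mono mult_mono abs_unit_comp_le_1) (auto simp: dist_norm norm_minus_commute)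
  finally show ?thesis by simp
qed simp

lemma unit_comp_mult_difference:
  assumes "norm y \<le> norm x"
  shows "\<bar>unit_comp i x * unit_comp j x - unit_comp i y * unit_comp j y\<bar> * norm y \<le> 4 * dist x y"
proof -
  have "unit_comp i x * unit_comp j x - unit_comp i y * unit_comp j y =
      unit_comp i x * (unit_comp j x - unit_comp j y) + unit_comp j y * (unit_comp i x - unit_comp i y)"
    by (simp add: algebra_simps)
  then have "\<bar>unit_comp i x * unit_comp j x - unit_comp i y * unit_comp j y\<bar> \<le>
      \<bar>unit_comp i x\<bar> * \<bar>unit_comp j x - unit_comp j y\<bar> + \<bar>unit_comp j y\<bar> * \<bar>unit_comp i x - unit_comp i y\<bar>"
    by (metis abs_mult abs_triangle_ineq)
  also have "\<dots> \<le> 1 * \<bar>unit_comp j x - unit_comp j y\<bar> + 1 * \<bar>unit_comp i x - unit_comp i y\<bar>"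
    by (intro add_mono mult_right_mono abs_unit_comp_le_1) auto
  finally have "\<bar>unit_comp i x * unit_comp j x - unit_comp i y * unit_comp j y\<bar> * norm y \<le>
      (\<bar>unit_comp j x - unit_comp j y\<bar> + \<bar>unit_comp i x - unit_comp i y\<bar>) * norm y"
    by (intro mult_right_mono) auto
  also have "\<dots> \<le> 4 * dist x y"
    using unit_comp_difference[OF assms, of i] unit_comp_difference[OF assms, of j]
    by (simp add: distrib_right)
  finally show ?thesis .
qed

lemma lipschitz_on_unit_comp:
  assumes "L-lipschitz_on {0..} h" "h 0 = 0"
  shows "(L + L * 2)-lipschitz_on UNIV (\<lambda>x. unit_comp i x * h (norm x))"
  by (rule lipschitz_on_angular[OF assms abs_unit_comp_le_1 unit_comp_difference]) auto

lemma lipschitz_on_unit_comp_mult: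
  assumes "L-lipschitz_on {0..} h" "h 0 = 0"
  shows "(L + L * 4)-lipschitz_on UNIV (\<lambda>x. unit_comp i x * unit_comp j x * h (norm x))"
proof (rule lipschitz_on_angular[OF assms _ unit_comp_mult_difference])
  show "\<bar>unit_comp i x * unit_comp j x\<bar> \<le> 1" for x :: "real^'a"
    unfolding abs_mult by (intro mult_le_one abs_unit_comp_le_1) auto
qed auto

section \<open>Maps into three-space, component by component\<close>

lemma vector_3_eq: "(vector [a, b, c] :: real^3) = a *\<^sub>R axis 1 1 + b *\<^sub>R axis 2 1 + c *\<^sub>R axis 3 1"
  by (simp add: vec_eq_iff forall_3 axis_def)

lemma norm_vector_3: "(norm (vector [a, b, c] :: real^3))\<^sup>2 = a\<^sup>2 + b\<^sup>2 + c\<^sup>2"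
  unfolding power2_norm_eq_inner by (simp add: inner_vec_def sum_3 power2_eq_square)

lemma lipschitz_on_vector_3:
  assumes "A-lipschitz_on X a" "B-lipschitz_on X b" "C-lipschitz_on X c"
  shows "(A + B + C)-lipschitz_on X (\<lambda>x. vector [a x, b x, c x] :: real^3)"
proof (rule lipschitz_onI)
  show "0 \<le> A + B + C"
    using assms[THEN lipschitz_on_nonneg] by simp
  fix x y assume xy: "x \<in> X" "y \<in> X"
  have "dist (vector [a x, b x, c x] :: real^3) (vector [a y, b y, c y]) \<le>
      dist (a x) (a y) + dist (b x) (b y) + dist (c x) (c y)"
    using norm_le_l1_cart[of "vector [a x, b x, c x] - vector [a y, b y, c y] :: real^3"]
    by (simp add: dist_norm sum_3)
  also have "\<dots> \<le> (A + B + C) * dist x y"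
    using lipschitz_onD[OF assms(1) xy] lipschitz_onD[OF assms(2) xy] lipschitz_onD[OF assms(3) xy]
    by (simp add: distrib_right)
  finally show "dist (vector [a x, b x, c x] :: real^3) (vector [a y, b y, c y]) \<le> (A + B + C) * dist x y" .
qed

lemma has_vector_derivative_vector_3:
  assumes "(a has_real_derivative a') (at t)" "(b has_real_derivative b') (at t)" "(c has_real_derivative c') (at t)"
  shows "((\<lambda>t. vector [a t, b t, c t] :: real^3) has_vector_derivative vector [a', b', c']) (at t)"
  unfolding vector_3_eq using assms
  by (auto intro!: derivative_eq_intros)

section \<open>The trial map\<close>

definition profile' :: "real \<Rightarrow> real" where
  "profile' t = - 2 * pi * max 0 (1 - t)"

text \<open>This form shows the profile as a C^1 function on the whole line. Negative arguments are
  included, so its derivative at t = 0 is two-sided.\<close>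

lemma profile_eq: "profile t = pi * (max 0 (1 - t))\<^sup>2"
  by (simp add: profile_def max_def)

lemma DERIV_max_0_power2: "((\<lambda>x. (max 0 x)\<^sup>2) has_real_derivative 2 * max 0 x) (at (x::real))"
proof (cases x "0::real" rule: linorder_cases)
  case less
  have "((\<lambda>_. 0) has_real_derivative 0) (at x)" by simp
  then have "((\<lambda>x. (max 0 x)\<^sup>2) has_real_derivative 0) (at x)"
    by (rule has_field_derivative_transform_within_open[where S="{..<0}"]) (use less in auto)
  then show ?thesis using less by simp
next
  case equal
  have "((\<lambda>h::real. max 0 h * (max 0 h / h)) \<longlongrightarrow> 0) (at 0)"
  proof (rule Lim_null_comparison)
    show "\<forall>\<^sub>F h in at 0. norm (max 0 h * (max 0 h / h)) \<le> norm (h::real)"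
      by (auto simp: eventually_at_filter max_def)
    show "((\<lambda>h::real. norm h) \<longlongrightarrow> 0) (at 0)"
      by (intro tendsto_norm_zero tendsto_ident_at)
  qed
  then show ?thesis using equal by (simp add: DERIV_def power2_eq_square)
next
  case greater
  have "((\<lambda>x. x\<^sup>2) has_real_derivative 2 * x) (at x)"
    by (auto intro!: derivative_eq_intros)
  then have "((\<lambda>x. (max 0 x)\<^sup>2) has_real_derivative 2 * x) (at x)"
    by (rule has_field_derivative_transform_within_open[where S="{0<..}"]) (use greater in auto)
  then show ?thesis using greater by simp
qed

lemma DERIV_profile [derivative_intros]:
  "(f has_real_derivative D) (at x within S) \<Longrightarrow>
    ((\<lambda>x. profile (f x)) has_real_derivative profile' (f x) * D) (at x within S)"
proof -
  have "((\<lambda>t. (max 0 (1 - t))\<^sup>2) has_real_derivative 2 * max 0 (1 - t) * - 1) (at t)" for t :: real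
    by (rule DERIV_chain2[OF DERIV_max_0_power2]) (auto intro!: derivative_eq_intros)
  from DERIV_cmult[OF this, of pi] have "(profile has_real_derivative profile' t) (at t)" for t
    unfolding profile_eq[abs_def] profile'_def by (simp add: mult_ac)
  then show "(f has_real_derivative D) (at x within S) \<Longrightarrow> ?thesis"
    by (rule DERIV_chain2)
qed

lemma abs_profile'_le: "0 \<le> t \<Longrightarrow> \<bar>profile' t\<bar> \<le> 2 * pi"
  by (auto simp: profile'_def abs_mult)

lemma lipschitz_on_profile': "(2 * pi)-lipschitz_on UNIV profile'"
  by (rule lipschitz_onI)
     (auto simp: profile'_def dist_real_def max_def abs_if algebra_simps)

lemma lipschitz_on_DERIV_bounded:
  fixes f :: "real \<Rightarrow> real"
  assumes "\<And>t. 0 \<le> t \<Longrightarrow> (f has_real_derivative f' t) (at t)" "\<And>t. 0 \<le> t \<Longrightarrow> \<bar>f' t\<bar> \<le> B" "0 \<le> B"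
  shows "B-lipschitz_on {0..} f"
proof (rule lipschitz_onI)
  fix x y :: real assume xy: "x \<in> {0..}" "y \<in> {0..}"
  have "norm (f x - f y) \<le> B * norm (x - y)"
    by (rule field_differentiable_bound[where S="{0..}" and f'=f'])
       (use assms xy in \<open>auto intro: has_field_derivative_at_within\<close>)
  then show "dist (f x) (f y) \<le> B * dist x y" by (simp add: dist_norm)
qed (use assms in auto)

definition sin_profile' :: "real \<Rightarrow> real" where
  "sin_profile' t = cos (profile t) * profile' t"

definition cos_profile' :: "real \<Rightarrow> real" where
  "cos_profile' t = - sin (profile t) * profile' t"

lemma DERIV_sin_profile: "((\<lambda>t. sin (profile t)) has_real_derivative sin_profile' t) (at t)"
  unfolding sin_profile'_def by (auto intro!: derivative_eq_intros)

lemma DERIV_cos_profile: "((\<lambda>t. cos (profile t)) has_real_derivative cos_profile' t) (at t)"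
  unfolding cos_profile'_def by (auto intro!: derivative_eq_intros)

lemma abs_sin_cos_profile'_le:
  assumes "0 \<le> t"
  shows "\<bar>sin_profile' t\<bar> \<le> 2 * pi" "\<bar>cos_profile' t\<bar> \<le> 2 * pi"
  using mult_mono[OF abs_cos_le_one abs_profile'_le[OF assms], of "profile t"]
    mult_mono[OF abs_sin_le_one abs_profile'_le[OF assms], of "profile t"]
  by (auto simp: sin_profile'_def cos_profile'_def abs_mult)

lemma lipschitz_on_sin_profile: "(2 * pi)-lipschitz_on {0..} (\<lambda>t. sin (profile t))"
  by (rule lipschitz_on_DERIV_bounded[OF DERIV_sin_profile abs_sin_cos_profile'_le(1)]) auto

lemma lipschitz_on_cos_profile: "(2 * pi)-lipschitz_on {0..} (\<lambda>t. cos (profile t))"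
  by (rule lipschitz_on_DERIV_bounded[OF DERIV_cos_profile abs_sin_cos_profile'_le(2)]) auto

text \<open>Product rule for Lipschitz constants: the cosine has bound 1 and constant 2 pi,
  \<open>profile'\<close> has bound 2 pi and constant 2 pi, which gives 1 * 2 pi + 2 pi * 2
  pi.\<close>

lemma lipschitz_on_sin_profile': "(2 * pi + 4 * pi\<^sup>2)-lipschitz_on {0..} sin_profile'"
  using lipschitz_on_mult_real[OF lipschitz_on_cos_profile lipschitz_on_subset[OF lipschitz_on_profile'],
      of "1" "2 * pi"] abs_profile'_le
  by (simp add: sin_profile'_def[abs_def] power2_eq_square)

lemma lipschitz_on_cos_profile': "(2 * pi + 4 * pi\<^sup>2)-lipschitz_on {0..} cos_profile'"
proof -
  have "(2 * pi + 4 * pi\<^sup>2)-lipschitz_on {0..} (\<lambda>t. sin (profile t) * profile' t)"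
    using lipschitz_on_mult_real[OF lipschitz_on_sin_profile lipschitz_on_subset[OF lipschitz_on_profile'],
      of "1" "2 * pi"] abs_profile'_le
    by (simp add: power2_eq_square)
  from lipschitz_on_minus[OF this] show ?thesis by (simp add: cos_profile'_def[abs_def])
qed

text \<open>In polar form \<open>\<partial>\<^sub>i w\<^sub>j = \<delta>\<^sub>i\<^sub>j \<alpha> + e\<^sub>i e\<^sub>j \<beta>\<close> for \<open>j = 1, 2\<close>, where \<open>e = x / r\<close>, \<open>\<alpha> = \<sigma> / r\<close> and
  \<open>\<beta> = \<sigma>' - \<alpha>\<close> with \<open>\<sigma> = sin f\<close>.\<close>

definition slope :: "real \<Rightarrow> real" where
  "slope t = (if t = 0 then sin_profile' 0 else sin (profile t) / t)"

definition trial_grad :: "2 \<Rightarrow> real^2 \<Rightarrow> real^3" where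
  "trial_grad i x = vector
    [(if i = 1 then slope (norm x) else 0) + unit_comp i x * unit_comp 1 x * (sin_profile' (norm x) - slope (norm x)),
     (if i = 2 then slope (norm x) else 0) + unit_comp i x * unit_comp 2 x * (sin_profile' (norm x) - slope (norm x)),
     unit_comp i x * cos_profile' (norm x)]"

lemma trial_map_1_eq:
  "trial_map 1 x = vector [unit_comp 1 x * sin (profile (norm x)), unit_comp 2 x * sin (profile (norm x)),
     cos (profile (norm x))]"
  by (simp add: trial_map_def unit_comp_def mult.commute)

lemma lipschitz_trial_map: "\<exists>L. L-lipschitz_on UNIV (trial_map 1)"
proof -
  have "sin (profile 0) = 0" by (simp add: profile_def)
  from lipschitz_on_vector_3[OF lipschitz_on_unit_comp[OF lipschitz_on_sin_profile this, of 1]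
      lipschitz_on_unit_comp[OF lipschitz_on_sin_profile this, of 2]
      lipschitz_on_norm_comp[OF lipschitz_on_cos_profile]]
  show ?thesis unfolding trial_map_1_eq[abs_def] by blast
qed

lemma lipschitz_on_slope_profile: "(2 * pi + 4 * pi\<^sup>2)-lipschitz_on {0..} slope"
  unfolding slope_def[abs_def]
  by (rule lipschitz_on_slope[OF DERIV_sin_profile lipschitz_on_sin_profile']) (simp add: profile_def)

lemma lipschitz_trial_grad: "\<exists>L. L-lipschitz_on UNIV (trial_grad i)"
proof -
  have b: "\<exists>L. L-lipschitz_on {0..} (\<lambda>t. sin_profile' t - slope t)"
    using lipschitz_on_diff[OF lipschitz_on_sin_profile' lipschitz_on_slope_profile] by blast
  then obtain L where L: "L-lipschitz_on {0..} (\<lambda>t. sin_profile' t - slope t)" ..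
  \<comment> \<open>The radial factors next to angular terms must vanish at the origin. The first
    does because \<open>slope 0\<close> is defined as the limit \<open>sin_profile' 0\<close>, the
    second because f(0) = pi.\<close>
  have z: "sin_profile' 0 - slope 0 = 0" "cos_profile' 0 = 0"
    by (simp_all add: slope_def cos_profile'_def profile_def)
  have a: "\<exists>M. M-lipschitz_on UNIV (\<lambda>x::real^2. if P then slope (norm x) else 0)" for P
    using lipschitz_on_norm_comp[OF lipschitz_on_slope_profile] lipschitz_on_constant by (cases P) auto
  obtain M1 M2 where
    "M1-lipschitz_on UNIV (\<lambda>x::real^2. if i = 1 then slope (norm x) else 0)"
    "M2-lipschitz_on UNIV (\<lambda>x::real^2. if i = 2 then slope (norm x) else 0)"
    using a by blast
  from lipschitz_on_vector_3[OF lipschitz_on_add[OF this(1) lipschitz_on_unit_comp_mult[OF L z(1), of i 1]]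
      lipschitz_on_add[OF this(2) lipschitz_on_unit_comp_mult[OF L z(1), of i 2]]
      lipschitz_on_unit_comp[OF lipschitz_on_cos_profile' z(2), of i]]
  show ?thesis unfolding trial_grad_def[abs_def] by blast
qed

section \<open>Directional derivatives away from the singular set\<close>

lemma DERIV_norm_line:
  fixes x :: "real^'n::finite"
  assumes "x + t *\<^sub>R axis i 1 \<noteq> 0"
  shows "((\<lambda>t. norm (x + t *\<^sub>R axis i 1)) has_real_derivative unit_comp i (x + t *\<^sub>R axis i 1)) (at t)"
proof -
  have "((\<lambda>t. norm (x + t *\<^sub>R axis i 1)) has_derivative
      (\<lambda>s. (s *\<^sub>R axis i 1) \<bullet> sgn (x + t *\<^sub>R axis i 1))) (at t)"
    by (rule has_derivative_compose[where f="\<lambda>t. x + t *\<^sub>R axis i 1" and g=norm, OF _ has_derivative_norm[OF assms]])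
       (auto intro!: derivative_eq_intros)
  moreover have "(\<lambda>s. (s *\<^sub>R axis i 1) \<bullet> sgn (x + t *\<^sub>R axis i 1)) = (*) (unit_comp i (x + t *\<^sub>R axis i 1))"
    by (simp add: fun_eq_iff inner_axis' sgn_div_norm unit_comp_def divide_inverse mult_ac)
  ultimately show ?thesis by (simp add: has_field_derivative_def)
qed

lemma DERIV_unit_comp_line:
  fixes x :: "real^'n::finite"
  assumes "x + t *\<^sub>R axis i 1 \<noteq> 0"
  shows "((\<lambda>t. unit_comp j (x + t *\<^sub>R axis i 1)) has_real_derivative
    ((if i = j then 1 else 0) - unit_comp i (x + t *\<^sub>R axis i 1) * unit_comp j (x + t *\<^sub>R axis i 1))
      / norm (x + t *\<^sub>R axis i 1)) (at t)"
proof -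
  have "((\<lambda>t. (x + t *\<^sub>R axis i 1) $ j) has_real_derivative (if i = j then 1 else 0)) (at t)"
    by (auto intro!: derivative_eq_intros simp: axis_def)
  from DERIV_divide[OF this DERIV_norm_line[OF assms]] show ?thesis
    using assms unfolding unit_comp_def by (rule_tac DERIV_cong) (auto simp: field_simps power2_eq_square)
qed

lemma trial_map_has_grad:
  assumes "x \<noteq> 0"
  shows "((\<lambda>t. trial_map 1 (x + t *\<^sub>R axis i 1)) has_vector_derivative trial_grad i x) (at 0)"
proof -
  have x: "x + 0 *\<^sub>R axis i 1 \<noteq> 0" using assms by simp
  have j: "((\<lambda>t. unit_comp j (x + t *\<^sub>R axis i 1) * sin (profile (norm (x + t *\<^sub>R axis i 1)))) has_real_derivative
      (if i = j then slope (norm x) else 0) + unit_comp i x * unit_comp j x * (sin_profile' (norm x) - slope (norm x))) (at 0)" for j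
    by (rule DERIV_cong[OF DERIV_mult[OF DERIV_unit_comp_line[OF x]
            DERIV_chain2[where f="\<lambda>t. sin (profile t)", OF DERIV_sin_profile DERIV_norm_line[OF x]]]])
       (use assms in \<open>auto simp: slope_def field_simps\<close>)
  have "((\<lambda>t. cos (profile (norm (x + t *\<^sub>R axis i 1)))) has_real_derivative unit_comp i x * cos_profile' (norm x)) (at 0)"
    by (rule DERIV_cong[OF DERIV_chain2[where f="\<lambda>t. cos (profile t)", OF DERIV_cos_profile DERIV_norm_line[OF x]]])
       simp
  from has_vector_derivative_vector_3[OF j[of 1] j[of 2] this] show ?thesis
    unfolding trial_map_1_eq trial_grad_def .
qed

text \<open>The derivative of \<open>profile'\<close> jumps from 2 pi to 0 at t = 1; this is the
  origin of the exceptional circle.\<close>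

lemma differentiable_profile':
  assumes "t \<noteq> 1"
  shows "profile' differentiable (at t)"
proof (cases "t < 1")
  case True
  have "((\<lambda>t. - 2 * pi * (1 - t)) has_real_derivative 2 * pi) (at t)"
    by (auto intro!: derivative_eq_intros)
  then have "(profile' has_real_derivative 2 * pi) (at t)"
    by (rule has_field_derivative_transform_within_open[where S="{..<1}"]) (use True in \<open>auto simp: profile'_def\<close>)
  then show ?thesis by (auto intro: differentiableI simp: has_field_derivative_def)
next
  case False
  have "((\<lambda>t. 0) has_real_derivative 0) (at t)" by simp
  then have "(profile' has_real_derivative 0) (at t)"
    by (rule has_field_derivative_transform_within_open[where S="{1<..}"]) (use False assms in \<open>auto simp: profile'_def\<close>)
  then show ?thesis by (auto intro: differentiableI simp: has_field_derivative_def)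
qed

lemma real_differentiable_iff: "f differentiable (at (t::real)) \<longleftrightarrow> (\<exists>D. (f has_real_derivative D) (at t))"
  using real_differentiable_def by blast

text \<open>Only existence is asserted. The second derivatives keep an implicit form as
  \<open>trial_hess\<close>, and the one fact extracted from them later is an identity for their
  inner product with the map.\<close>

lemma trial_grad_differentiable:
  assumes "x \<noteq> 0" "norm x \<noteq> 1"
  shows "\<exists>D. ((\<lambda>t. trial_grad i (x + t *\<^sub>R axis j 1)) has_vector_derivative D) (at 0)"
proof -
  have x: "x + 0 *\<^sub>R axis j 1 \<noteq> 0" using assms by simp
  have r: "norm x \<noteq> 0" using assms by simp
  obtain p where p: "(profile' has_real_derivative p) (at (norm x))"
    using differentiable_profile'[OF assms(2)] by (auto simp: real_differentiable_iff)
  have s: "(sin_profile' has_real_derivative cos_profile' (norm x) * profile' (norm x) + p * cos (profile (norm x))) (at (norm x))"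
    using DERIV_mult[OF DERIV_cos_profile p] by (simp add: sin_profile'_def[abs_def])
  have c: "(cos_profile' has_real_derivative - sin_profile' (norm x) * profile' (norm x) + p * - sin (profile (norm x))) (at (norm x))"
    using DERIV_mult[OF DERIV_minus[OF DERIV_sin_profile] p] by (simp add: cos_profile'_def[abs_def])
  obtain a where a: "(slope has_real_derivative a) (at (norm x))"
  proof -
    have "((\<lambda>t. sin (profile t) / t) has_real_derivative
        (sin_profile' (norm x) * norm x - sin (profile (norm x)) * 1) / (norm x * norm x)) (at (norm x))"
      by (rule DERIV_divide[OF DERIV_sin_profile DERIV_ident r])
    then show thesis
      by (rule that[OF has_field_derivative_transform_within_open[where S="- {0}"]]) (use r in \<open>auto simp: slope_def\<close>)
  qed
  have line: "((\<lambda>t. h (norm (x + t *\<^sub>R axis j 1))) has_real_derivative D * unit_comp j x) (at 0)"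
    if "(h has_real_derivative D) (at (norm x))" for h D
    using DERIV_chain2[of h D "\<lambda>t. norm (x + t *\<^sub>R axis j 1)" 0, OF _ DERIV_norm_line[OF x]] that by simp
  have e: "\<exists>D. ((\<lambda>t. unit_comp k (x + t *\<^sub>R axis j 1)) has_real_derivative D) (at 0)" for k
    using DERIV_unit_comp_line[OF x] by blast
  have A: "\<exists>D. ((\<lambda>t. if P then slope (norm (x + t *\<^sub>R axis j 1)) else 0) has_real_derivative D) (at 0)" for P
  proof (cases P)
    case True
    then show ?thesis using line[OF a] by auto
  next
    case False
    then show ?thesis by (intro exI[of _ 0]) simp
  qed
  have B: "\<exists>D. ((\<lambda>t. (if i = k then slope (norm (x + t *\<^sub>R axis j 1)) else 0) + unit_comp i (x + t *\<^sub>R axis j 1) * unit_comp k (x + t *\<^sub>R axis j 1) *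
      (sin_profile' (norm (x + t *\<^sub>R axis j 1)) - slope (norm (x + t *\<^sub>R axis j 1)))) has_real_derivative D) (at 0)" for k
  proof -
    obtain Da Di Dk where "((\<lambda>t. if i = k then slope (norm (x + t *\<^sub>R axis j 1)) else 0) has_real_derivative Da) (at 0)"
      "((\<lambda>t. unit_comp i (x + t *\<^sub>R axis j 1)) has_real_derivative Di) (at 0)"
      "((\<lambda>t. unit_comp k (x + t *\<^sub>R axis j 1)) has_real_derivative Dk) (at 0)"
      using A e by meson
    from DERIV_add[OF this(1) DERIV_mult[OF DERIV_mult[OF this(2,3)] DERIV_diff[OF line[OF s] line[OF a]]]]
    show ?thesis by blast
  qed
  obtain D3 where D3: "((\<lambda>t. unit_comp i (x + t *\<^sub>R axis j 1) * cos_profile' (norm (x + t *\<^sub>R axis j 1))) has_real_derivative D3) (at 0)"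
    using e[of i] DERIV_mult[OF _ line[OF c]] by blast
  obtain D1 where D1: "((\<lambda>t. (if i = 1 then slope (norm (x + t *\<^sub>R axis j 1)) else 0) + unit_comp i (x + t *\<^sub>R axis j 1) * unit_comp 1 (x + t *\<^sub>R axis j 1) *
      (sin_profile' (norm (x + t *\<^sub>R axis j 1)) - slope (norm (x + t *\<^sub>R axis j 1)))) has_real_derivative D1) (at 0)"
    using B[of 1] ..
  obtain D2 where D2: "((\<lambda>t. (if i = 2 then slope (norm (x + t *\<^sub>R axis j 1)) else 0) + unit_comp i (x + t *\<^sub>R axis j 1) * unit_comp 2 (x + t *\<^sub>R axis j 1) *
      (sin_profile' (norm (x + t *\<^sub>R axis j 1)) - slope (norm (x + t *\<^sub>R axis j 1)))) has_real_derivative D2) (at 0)"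
    using B[of 2] ..
  show ?thesis
    using has_vector_derivative_vector_3[OF D1 D2 D3] unfolding trial_grad_def by blast
qed

definition trial_hess :: "2 \<Rightarrow> 2 \<Rightarrow> real^2 \<Rightarrow> real^3" where
  "trial_hess i j x = vector_derivative (\<lambda>t. trial_grad i (x + t *\<^sub>R axis j 1)) (at 0)"

lemma trial_grad_has_hess:
  assumes "x \<noteq> 0" "norm x \<noteq> 1"
  shows "((\<lambda>t. trial_grad i (x + t *\<^sub>R axis j 1)) has_vector_derivative trial_hess i j x) (at 0)"
  using trial_grad_differentiable[OF assms] unfolding trial_hess_def
  by (metis vector_derivative_at)

section \<open>Pointwise identities for the gradient\<close>

lemma unit_comp_sum_squares: "x \<noteq> 0 \<Longrightarrow> (unit_comp 1 x)\<^sup>2 + (unit_comp 2 x)\<^sup>2 = 1" for x :: "real^2"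
proof -
  assume "x \<noteq> 0"
  have "(norm x)\<^sup>2 = (x $ 1)\<^sup>2 + (x $ 2)\<^sup>2"
    unfolding power2_norm_eq_inner by (simp add: inner_vec_def sum_2 power2_eq_square)
  then show ?thesis
    using \<open>x \<noteq> 0\<close> by (simp add: unit_comp_def power_divide add_divide_distrib[symmetric] flip: \<open>(norm x)\<^sup>2 = _\<close>)
qed

lemma inner_vector_3: "(vector [a, b, c] :: real^3) \<bullet> vector [a', b', c'] = a * a' + b * b' + c * c'"
  by (simp add: inner_vec_def sum_3)

text \<open>The planar block \<alpha> I + \<beta> e e^T has eigenvalues \<alpha> and \<alpha> +
  \<beta>, the latter being (sin f)'. Adding the square of (cos f)' to that of (sin f)' leaves
  f'^2.\<close>

lemma sum_trial_grad_sq: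
  assumes "x \<noteq> 0"
  shows "(\<Sum>i\<in>UNIV. (norm (trial_grad i x))\<^sup>2) = (profile' (norm x))\<^sup>2 + (sin (profile (norm x)) / norm x)\<^sup>2"
proof -
  let ?a = "slope (norm x)" let ?b = "sin_profile' (norm x) - ?a" let ?p = "unit_comp 1 x" let ?q = "unit_comp 2 x"
  have e: "?q\<^sup>2 = 1 - ?p\<^sup>2" using unit_comp_sum_squares[OF assms] by simp
  have "(\<Sum>i\<in>UNIV. (norm (trial_grad i x))\<^sup>2) =
    (?a + ?p * ?p * ?b)\<^sup>2 + (?p * ?q * ?b)\<^sup>2 + (?p * cos_profile' (norm x))\<^sup>2 +
    ((?q * ?p * ?b)\<^sup>2 + (?a + ?q * ?q * ?b)\<^sup>2 + (?q * cos_profile' (norm x))\<^sup>2)"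
    by (simp add: sum_2 trial_grad_def norm_vector_3)
  also have "\<dots> = ?a\<^sup>2 + (?a + ?b)\<^sup>2 + (cos_profile' (norm x))\<^sup>2"
    using e by algebra
  also have "\<dots> = ?a\<^sup>2 + ((sin (profile (norm x)))\<^sup>2 + (cos (profile (norm x)))\<^sup>2) * (profile' (norm x))\<^sup>2"
    by (simp add: sin_profile'_def cos_profile'_def power_mult_distrib algebra_simps del: sin_cos_squared_add sin_cos_squared_add2)
  finally show ?thesis using assms by (simp add: slope_def)
qed

lemma norm_trial_map: "norm (trial_map \<rho> x) = 1"
proof -
  have "(norm (trial_map \<rho> x))\<^sup>2 = 1"
  proof (cases "x = 0")
    case True
    then show ?thesis by (simp add: trial_map_def profile_def norm_vector_3)
  next
    case False
    then have "(x $ 1 / norm x)\<^sup>2 + (x $ 2 / norm x)\<^sup>2 = 1"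
      using unit_comp_sum_squares by (simp add: unit_comp_def)
    moreover have "(norm (trial_map \<rho> x))\<^sup>2 = (sin (profile (norm x / \<rho>)))\<^sup>2 * ((x $ 1 / norm x)\<^sup>2 + (x $ 2 / norm x)\<^sup>2) +
        (cos (profile (norm x / \<rho>)))\<^sup>2"
      unfolding trial_map_def norm_vector_3 by (simp only: power_mult_distrib distrib_left)
    ultimately show ?thesis by simp
  qed
  then show ?thesis by (simp add: power2_eq_1_iff) (metis norm_ge_zero not_one_le_zero neg_0_le_iff_le)
qed

text \<open>Since |e| = 1, the product equals e_i times sin f (sin f)' + cos f (cos f)', half the
  derivative of sin^2 f + cos^2 f.\<close>

lemma trial_map_inner_grad:
  assumes "x \<noteq> 0"
  shows "trial_map 1 x \<bullet> trial_grad i x = 0"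
proof -
  let ?a = "slope (norm x)" let ?b = "sin_profile' (norm x) - ?a" let ?p = "unit_comp 1 x" let ?q = "unit_comp 2 x"
  let ?s = "sin (profile (norm x))" let ?c = "cos (profile (norm x))"
  have e: "?q\<^sup>2 = 1 - ?p\<^sup>2" using unit_comp_sum_squares[OF assms] by simp
  have cs: "?s * sin_profile' (norm x) + ?c * cos_profile' (norm x) = 0"
    by (simp add: sin_profile'_def cos_profile'_def)
  consider "i = 1" | "i = 2" using exhaust_2 by blast
  then show ?thesis
  proof cases
    case 1
    have "?p * ?s * (?a + ?p * ?p * ?b) + ?q * ?s * (?p * ?q * ?b) + ?c * (?p * cos_profile' (norm x)) = 0"
      using e cs by algebra
    then show ?thesis using 1 by (simp add: trial_map_1_eq trial_grad_def inner_vector_3)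
  next
    case 2
    have "?p * ?s * (?q * ?p * ?b) + ?q * ?s * (?a + ?q * ?q * ?b) + ?c * (?q * cos_profile' (norm x)) = 0"
      using e cs by algebra
    then show ?thesis using 2 by (simp add: trial_map_1_eq trial_grad_def inner_vector_3)
  qed
qed

text \<open>Differentiating \<open>w \<bullet> \<partial>\<^sub>i w = 0\<close> once more.\<close>

lemma trial_map_inner_laplacian:
  assumes "x \<noteq> 0" "norm x \<noteq> 1"
  shows "trial_map 1 x \<bullet> (\<Sum>i\<in>UNIV. trial_hess i i x) = - (\<Sum>i\<in>UNIV. (norm (trial_grad i x))\<^sup>2)"
proof -
  have "trial_map 1 x \<bullet> trial_hess i i x = - (norm (trial_grad i x))\<^sup>2" for i
  proof -
    have "((\<lambda>t. trial_map 1 (x + t *\<^sub>R axis i 1) \<bullet> trial_grad i (x + t *\<^sub>R axis i 1)) has_vector_derivative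
        trial_map 1 (x + 0 *\<^sub>R axis i 1) \<bullet> trial_hess i i x + trial_grad i x \<bullet> trial_grad i (x + 0 *\<^sub>R axis i 1)) (at 0)"
      by (rule bounded_bilinear.has_vector_derivative[OF bounded_bilinear_inner
            trial_map_has_grad[OF assms(1)] trial_grad_has_hess[OF assms]])
    moreover have "((\<lambda>t. trial_map 1 (x + t *\<^sub>R axis i 1) \<bullet> trial_grad i (x + t *\<^sub>R axis i 1)) has_vector_derivative 0) (at 0)"
    proof (rule has_vector_derivative_transform_within_open[where S="{t. 0 < norm (x + t *\<^sub>R axis i 1)}"])
      \<comment> \<open>Orthogonality is known off the origin only, hence the open set of parameters
        at which the line avoids it.\<close>
      show "((\<lambda>_. 0 :: real) has_vector_derivative 0) (at 0)" by simp
      show "open {t. 0 < norm (x + t *\<^sub>R axis i 1)}"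
        by (intro open_Collect_less continuous_intros)
    qed (use assms trial_map_inner_grad in auto)
    ultimately have "trial_map 1 x \<bullet> trial_hess i i x + trial_grad i x \<bullet> trial_grad i x = 0"
      using vector_derivative_unique_at by fastforce
    then show ?thesis by (simp add: power2_norm_eq_inner)
  qed
  then show ?thesis by (simp add: inner_sum_right sum_negf)
qed

text \<open>In the frame of e and its rotation by a right angle, the radial derivative is ((sin f)'
  e, (cos f)') and the angular one is \<alpha> times the rotated vector. The triple product is
  \<alpha> (cos f (sin f)' - sin f (cos f)'), and the bracket equals f'.\<close>

lemma trial_map_degree_density:
  assumes "x \<noteq> 0"
  shows "trial_map 1 x \<bullet> cross3 (trial_grad 1 x) (trial_grad 2 x) =
    sin (profile (norm x)) / norm x * profile' (norm x)"
proof -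
  let ?a = "slope (norm x)" let ?b = "sin_profile' (norm x) - ?a" let ?p = "unit_comp 1 x" let ?q = "unit_comp 2 x"
  let ?s = "sin (profile (norm x))" let ?c = "cos (profile (norm x))" let ?d = "cos_profile' (norm x)"
  have e: "?q\<^sup>2 = 1 - ?p\<^sup>2" using unit_comp_sum_squares[OF assms] by simp
  have cs: "?c * sin_profile' (norm x) - ?s * ?d = profile' (norm x)"
  proof -
    have "?c * sin_profile' (norm x) - ?s * ?d = (?s\<^sup>2 + ?c\<^sup>2) * profile' (norm x)"
      unfolding sin_profile'_def cos_profile'_def by algebra
    then show ?thesis by simp
  qed
  have "trial_map 1 x \<bullet> cross3 (trial_grad 1 x) (trial_grad 2 x) =
    ?p * ?s * ((?p * ?q * ?b) * (?q * ?d) - (?p * ?d) * (?a + ?q * ?q * ?b)) +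
    ?q * ?s * ((?p * ?d) * (?q * ?p * ?b) - (?a + ?p * ?p * ?b) * (?q * ?d)) +
    ?c * ((?a + ?p * ?p * ?b) * (?a + ?q * ?q * ?b) - (?p * ?q * ?b) * (?q * ?p * ?b))"
    by (simp add: trial_map_1_eq trial_grad_def cross3_def inner_vector_3)
  also have "\<dots> = ?a * (?c * sin_profile' (norm x) - ?s * ?d)"
    using e by algebra
  finally show ?thesis using assms cs by (simp add: slope_def)
qed

section \<open>Dilation to radius rho, admissibility and weak derivatives\<close>

lemma trial_map_scale:
  assumes "0 < \<rho>"
  shows "trial_map \<rho> x = trial_map 1 (x /\<^sub>R \<rho>)"
  using assms by (simp add: trial_map_def field_simps)

lemma trial_map_outside: "1 \<le> norm x \<Longrightarrow> trial_map 1 x = e3"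
  by (simp add: trial_map_def profile_eq e3_def)

lemma lipschitz_on_scale:
  fixes u :: "'a::real_normed_vector \<Rightarrow> 'b::real_normed_vector"
  assumes "L-lipschitz_on UNIV u"
  shows "(\<bar>b\<bar> * (L * \<bar>c\<bar>))-lipschitz_on UNIV (\<lambda>x. b *\<^sub>R u (c *\<^sub>R x))"
proof -
  have "(L * \<bar>c\<bar>)-lipschitz_on UNIV (\<lambda>x. u (c *\<^sub>R x))"
    by (rule lipschitz_on_compose2[OF lipschitz_on_cmult[OF lipschitz_on_id] lipschitz_on_subset[OF assms], simplified])
  then show ?thesis by (rule lipschitz_on_cmult)
qed

lemma has_vector_derivative_scale:
  fixes u :: "'a::real_normed_vector \<Rightarrow> 'b::real_normed_vector"
  assumes "((\<lambda>t. u (c *\<^sub>R x + t *\<^sub>R e)) has_vector_derivative v) (at 0)"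
  shows "((\<lambda>t. b *\<^sub>R u (c *\<^sub>R (x + t *\<^sub>R e))) has_vector_derivative (b * c) *\<^sub>R v) (at 0)"
proof -
  have "((\<lambda>t. c * t) has_vector_derivative c) (at (0::real))"
    by (auto intro!: derivative_eq_intros)
  then have "((\<lambda>t. u (c *\<^sub>R x + t *\<^sub>R e)) \<circ> (\<lambda>t. c * t) has_vector_derivative c *\<^sub>R v) (at 0)"
    by (rule vector_diff_chain_at) (use assms in simp)
  then have "((\<lambda>t. u (c *\<^sub>R (x + t *\<^sub>R e))) has_vector_derivative c *\<^sub>R v) (at 0)"
    by (simp add: o_def scaleR_add_right)
  from has_vector_derivative_scaleR[OF DERIV_const this] show ?thesis by simp
qed

context
  fixes \<rho> :: real
  assumes \<rho>: "0 < \<rho>"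
begin

lemma AE_regular: "AE x in lebesgue. x \<noteq> (0 :: real^2) \<and> norm x \<noteq> \<rho>"
proof -
  have "sphere (0::real^2) \<rho> \<in> null_sets lebesgue" "{0::real^2} \<in> null_sets lebesgue"
    using negligible_sphere[of "0::real^2" \<rho>] negligible_sing[of "0::real^2"]
    by (simp_all add: negligible_iff_null_sets)
  from AE_not_in[OF this(1)] AE_not_in[OF this(2)] show ?thesis
    by eventually_elim auto
qed

lemma trial_map_lipschitz: "\<exists>L. L-lipschitz_on UNIV (trial_map \<rho>)"
proof -
  obtain L where "L-lipschitz_on UNIV (trial_map 1)" using lipschitz_trial_map ..
  from lipschitz_on_scale[OF this, of 1 "inverse \<rho>"] show ?thesis
    unfolding trial_map_scale[OF \<rho>, abs_def] scaleR_one by (rule exI)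
qed

lemma trial_grad_lipschitz: "\<exists>L. L-lipschitz_on UNIV (\<lambda>x. trial_grad i (x /\<^sub>R \<rho>) /\<^sub>R \<rho>)"
proof -
  obtain L where "L-lipschitz_on UNIV (trial_grad i)" using lipschitz_trial_grad ..
  from lipschitz_on_scale[OF this, of "inverse \<rho>" "inverse \<rho>"] show ?thesis by (rule exI)
qed

lemma trial_map_scaled_grad:
  "AE x in lebesgue. ((\<lambda>t. trial_map \<rho> (x + t *\<^sub>R axis i 1)) has_vector_derivative
    trial_grad i (x /\<^sub>R \<rho>) /\<^sub>R \<rho>) (at 0)"
  using AE_regular
proof eventually_elim
  case (elim x)
  then have "x /\<^sub>R \<rho> \<noteq> 0" using \<rho> by simp
  from has_vector_derivative_scale[OF trial_map_has_grad[OF this], of 1] show ?case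
    by (simp add: trial_map_scale[OF \<rho>])
qed

lemma trial_grad_scaled_hess:
  "AE x in lebesgue. ((\<lambda>t. trial_grad i ((x + t *\<^sub>R axis j 1) /\<^sub>R \<rho>) /\<^sub>R \<rho>) has_vector_derivative
    trial_hess i j (x /\<^sub>R \<rho>) /\<^sub>R \<rho>\<^sup>2) (at 0)"
  using AE_regular
proof eventually_elim
  case (elim x)
  then have "x /\<^sub>R \<rho> \<noteq> 0" "norm (x /\<^sub>R \<rho>) \<noteq> 1" using \<rho> by (auto simp: field_simps)
  from has_vector_derivative_scale[OF trial_grad_has_hess[OF this], of "inverse \<rho>"] show ?case
    by (simp add: power2_eq_square)
qed

lemma trial_grad_outside: "\<rho> < norm x \<Longrightarrow> trial_grad i (x /\<^sub>R \<rho>) /\<^sub>R \<rho> = 0"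
proof -
  assume "\<rho> < norm x"
  then have x: "1 < norm (x /\<^sub>R \<rho>)" using \<rho> by (simp add: field_simps)
  then have "x /\<^sub>R \<rho> \<noteq> 0" by auto
  have "((\<lambda>_. e3) has_vector_derivative 0) (at (0::real))" by simp
  then have "((\<lambda>t. trial_map 1 (x /\<^sub>R \<rho> + t *\<^sub>R axis i 1)) has_vector_derivative 0) (at 0)"
  proof (rule has_vector_derivative_transform_within_open[where S="{t. 1 < norm (x /\<^sub>R \<rho> + t *\<^sub>R axis i 1)}"])
    show "open {t. 1 < norm (x /\<^sub>R \<rho> + t *\<^sub>R axis i 1)}"
      by (intro open_Collect_less continuous_intros)
  qed (use x trial_map_outside in auto)
  then have "trial_grad i (x /\<^sub>R \<rho>) = 0"
    using trial_map_has_grad[OF \<open>x /\<^sub>R \<rho> \<noteq> 0\<close>] vector_derivative_unique_at by blast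
  then show ?thesis by simp
qed

lemma has_weak_partial_trial_map:
  "has_weak_partial i (trial_map \<rho>) (\<lambda>x. trial_grad i (x /\<^sub>R \<rho>) /\<^sub>R \<rho>)"
proof -
  obtain L where L: "L-lipschitz_on UNIV (trial_map \<rho>)" using trial_map_lipschitz ..
  show ?thesis by (rule has_weak_partial_lipschitz[OF L trial_map_scaled_grad])
qed

lemma has_weak_partial_trial_grad:
  "has_weak_partial j (\<lambda>x. trial_grad i (x /\<^sub>R \<rho>) /\<^sub>R \<rho>) (\<lambda>x. trial_hess i j (x /\<^sub>R \<rho>) /\<^sub>R \<rho>\<^sup>2)"
proof -
  obtain L where L: "L-lipschitz_on UNIV (\<lambda>x. trial_grad i (x /\<^sub>R \<rho>) /\<^sub>R \<rho>)" using trial_grad_lipschitz ..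
  show ?thesis by (rule has_weak_partial_lipschitz[OF L trial_grad_scaled_hess])
qed

lemma trial_grad_H1: "(\<lambda>x. trial_grad i (x /\<^sub>R \<rho>) /\<^sub>R \<rho>) \<in> H1"
proof -
  obtain L where L: "L-lipschitz_on UNIV (\<lambda>x. trial_grad i (x /\<^sub>R \<rho>) /\<^sub>R \<rho>)" using trial_grad_lipschitz ..
  show ?thesis by (rule H1_lipschitz_support[OF L trial_grad_outside trial_grad_scaled_hess])
qed

lemma trial_hess_L2: "(\<lambda>x. trial_hess i j (x /\<^sub>R \<rho>) /\<^sub>R \<rho>\<^sup>2) \<in> L2"
proof -
  obtain L where L: "L-lipschitz_on UNIV (\<lambda>x. trial_grad i (x /\<^sub>R \<rho>) /\<^sub>R \<rho>)" using trial_grad_lipschitz ..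
  show ?thesis by (rule weak_partial_lipschitz_support[OF L trial_grad_outside trial_grad_scaled_hess])
qed

lemma trial_map_diff_e3_lipschitz: "\<exists>L. L-lipschitz_on UNIV (\<lambda>x. trial_map \<rho> x - e3)"
proof -
  obtain L where L: "L-lipschitz_on UNIV (trial_map \<rho>)" using trial_map_lipschitz ..
  show ?thesis by (rule exI, rule lipschitz_on_diff[OF L lipschitz_on_constant])
qed

lemma trial_map_diff_e3_grad:
  "AE x in lebesgue. ((\<lambda>t. trial_map \<rho> (x + t *\<^sub>R axis i 1) - e3) has_vector_derivative
    trial_grad i (x /\<^sub>R \<rho>) /\<^sub>R \<rho>) (at 0)"
  using trial_map_scaled_grad
  by eventually_elim (auto intro!: derivative_eq_intros)

lemma trial_map_diff_e3_H2: "(\<lambda>x. trial_map \<rho> x - e3) \<in> H2"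
proof -
  obtain L where L: "L-lipschitz_on UNIV (\<lambda>x. trial_map \<rho> x - e3)"
    using trial_map_diff_e3_lipschitz ..
  have "trial_map \<rho> x - e3 = 0" if "\<rho> < norm x" for x
    unfolding trial_map_scale[OF \<rho>] using that \<rho> by (subst trial_map_outside) (auto simp: field_simps)
  from H1_lipschitz_support[OF L this trial_map_diff_e3_grad]
  have "(\<lambda>x. trial_map \<rho> x - e3) \<in> L2" by (simp add: H1_def)
  then show ?thesis
    using has_weak_partial_lipschitz[OF L trial_map_diff_e3_grad] trial_grad_H1
    unfolding H2_def by blast
qed

lemma trial_map_admissible: "trial_map \<rho> \<in> admissible"
  using trial_map_diff_e3_H2 by (simp add: admissible_def norm_trial_map)

lemma weak_partial_trial_map:
  "AE x in lebesgue. weak_partial i (trial_map \<rho>) x = trial_grad i (x /\<^sub>R \<rho>) /\<^sub>R \<rho>"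
  by (rule weak_partial_AE_eq[OF has_weak_partial_trial_map])

lemma weak_laplacian_trial_map:
  "AE x in lebesgue. weak_laplacian (trial_map \<rho>) x = (\<Sum>i\<in>UNIV. trial_hess i i (x /\<^sub>R \<rho>)) /\<^sub>R \<rho>\<^sup>2"
proof -
  have "AE x in lebesgue. weak_partial i (weak_partial i (trial_map \<rho>)) x = trial_hess i i (x /\<^sub>R \<rho>) /\<^sub>R \<rho>\<^sup>2" for i
    by (rule weak_partial_AE_eq[OF has_weak_partial_cong_AE[OF has_weak_partial_trial_grad weak_partial_trial_map]])
  from this[of 1] this[of 2] show ?thesis
    by eventually_elim (simp add: weak_laplacian_def sum_2 scaleR_add_right)
qed

lemma weak_grad_sq_trial_map:
  "AE x in lebesgue. weak_grad_sq (trial_map \<rho>) x = (\<Sum>i\<in>UNIV. (norm (trial_grad i (x /\<^sub>R \<rho>)))\<^sup>2) / \<rho>\<^sup>2"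
  using weak_partial_trial_map[of 1] weak_partial_trial_map[of 2]
proof eventually_elim
  case (elim x)
  then show ?case
    by (simp add: weak_grad_sq_def sum_2 power_mult_distrib divide_inverse distrib_left mult.commute power_inverse)
qed

lemma weak_grad_sq_integrable: "integrable lebesgue (\<lambda>x. \<Sum>i\<in>UNIV. (norm (trial_grad i (x /\<^sub>R \<rho>) /\<^sub>R \<rho>))\<^sup>2)"
  using trial_grad_H1 by (intro Bochner_Integration.integrable_sum) (simp add: H1_def L2_def)

lemma weak_laplacian_sq_integrable:
  "integrable lebesgue (\<lambda>x. (norm ((\<Sum>i\<in>UNIV. trial_hess i i (x /\<^sub>R \<rho>)) /\<^sub>R \<rho>\<^sup>2))\<^sup>2)"
proof -
  let ?H = "\<lambda>i x. trial_hess i i (x /\<^sub>R \<rho>) /\<^sub>R \<rho>\<^sup>2"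
  have m: "?H i \<in> borel_measurable lebesgue" and I: "integrable lebesgue (\<lambda>x. (norm (?H i x))\<^sup>2)" for i
    using trial_hess_L2[of i i] by (auto simp: L2_def)
  have eq: "(\<lambda>x. (\<Sum>i\<in>UNIV. trial_hess i i (x /\<^sub>R \<rho>)) /\<^sub>R \<rho>\<^sup>2) = (\<lambda>x. ?H 1 x + ?H 2 x)"
    by (simp add: sum_2 scaleR_add_right)
  have "integrable lebesgue (\<lambda>x. (norm (?H 1 x + ?H 2 x))\<^sup>2)"
  proof (rule Bochner_Integration.integrable_bound)
    show "integrable lebesgue (\<lambda>x. 2 * (norm (?H 1 x))\<^sup>2 + 2 * (norm (?H 2 x))\<^sup>2)"
      by (intro Bochner_Integration.integrable_add integrable_mult_right I)
    show "(\<lambda>x. (norm (?H 1 x + ?H 2 x))\<^sup>2) \<in> borel_measurable lebesgue"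
      by (intro borel_measurable_power measurable_compose[OF borel_measurable_add[OF m m] borel_measurable_norm])
    have "(norm (a + b))\<^sup>2 \<le> 2 * (norm a)\<^sup>2 + 2 * (norm b)\<^sup>2" for a b :: "real^3"
    proof -
      have "(norm (a + b))\<^sup>2 \<le> (norm a + norm b)\<^sup>2"
        by (intro power_mono norm_triangle_ineq) simp
      also have "\<dots> \<le> 2 * (norm a)\<^sup>2 + 2 * (norm b)\<^sup>2"
        using sum_squares_bound[of "norm a" "norm b"] by (simp add: power2_sum)
      finally show ?thesis .
    qed
    then have "norm ((norm (a + b))\<^sup>2) \<le> norm (2 * (norm a)\<^sup>2 + 2 * (norm b)\<^sup>2)" for a b :: "real^3"
      by simp
    then show "AE x in lebesgue. norm ((norm (?H 1 x + ?H 2 x))\<^sup>2) \<le> norm (2 * (norm (?H 1 x))\<^sup>2 + 2 * (norm (?H 2 x))\<^sup>2)"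
      by (intro always_eventually allI)
  qed
  then show ?thesis unfolding eq[unfolded fun_eq_iff, rule_format] .
qed

end

section \<open>Scaling of the three energy terms\<close>

lemma has_bochner_integral_lebesgue_AE:
  fixes f g :: "'a::euclidean_space \<Rightarrow> 'b::euclidean_space"
  assumes "has_bochner_integral lebesgue f I" "AE x in lebesgue. g x = f x"
  shows "has_bochner_integral lebesgue g I"
proof -
  have f: "f \<in> borel_measurable lebesgue"
    using assms(1) by (auto simp: has_bochner_integral_iff)
  then have "g \<in> borel_measurable lebesgue"
    by (rule borel_measurable_AE) (use assms(2) in auto)
  then show ?thesis
    using has_bochner_integral_cong_AE[of g lebesgue f I] assms f by blast
qed

lemma lebesgue_integral_dilation:
  fixes f :: "real^2 \<Rightarrow> real"
  assumes "f \<in> borel_measurable lebesgue" "0 < \<rho>"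
  shows "(LINT x|lebesgue. f (x /\<^sub>R \<rho>)) = \<rho>\<^sup>2 * (LINT x|lebesgue. f x)"
  using lebesgue_integral_affine[OF assms(1), of "inverse \<rho>" 0] assms(2)
  by (simp add: power2_eq_square field_simps)

lemma power2_norm_divideR: "(norm (v /\<^sub>R c))\<^sup>2 = (norm v)\<^sup>2 / c\<^sup>2"
proof -
  have "norm (v /\<^sub>R c) = norm v / \<bar>c\<bar>" by (simp add: divide_inverse_commute)
  then show ?thesis by (simp only: power_divide power2_abs)
qed

text \<open>Conformal invariance in the plane: the factor rho^-2 from two first derivatives cancels
  rho^2 from the area element.\<close>

lemma weak_grad_sq_trial_map_integral:
  assumes "0 < \<rho>"
  shows "has_bochner_integral lebesgue (weak_grad_sq (trial_map \<rho>)) (2 * D0)"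
proof -
  let ?g = "\<lambda>x. \<Sum>i\<in>UNIV. (norm (trial_grad i x))\<^sup>2"
  have scaled: "(\<Sum>i\<in>UNIV. (norm (trial_grad i (x /\<^sub>R \<rho>) /\<^sub>R \<rho>))\<^sup>2) = ?g (x /\<^sub>R \<rho>) / \<rho>\<^sup>2" if "0 < \<rho>" for \<rho> x
    by (simp only: sum_2 power2_norm_divideR add_divide_distrib)
  have int1: "integrable lebesgue ?g"
    using weak_grad_sq_integrable[OF zero_less_one] by simp
  have "AE x in lebesgue. weak_grad_sq (trial_map 1) x = ?g x"
    using weak_grad_sq_trial_map[OF zero_less_one] by simp
  with has_bochner_integral_integrable[OF int1]
  have "has_bochner_integral lebesgue (weak_grad_sq (trial_map 1)) (LINT x|lebesgue. ?g x)"
    by (rule has_bochner_integral_lebesgue_AE)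
  then have D0: "2 * D0 = (LINT x|lebesgue. ?g x)"
    by (simp add: D0_def has_bochner_integral_iff)
  have "integrable lebesgue (\<lambda>x. ?g (x /\<^sub>R \<rho>) / \<rho>\<^sup>2)"
    using weak_grad_sq_integrable[OF assms] by (simp only: scaled[OF assms])
  moreover have "(LINT x|lebesgue. ?g (x /\<^sub>R \<rho>) / \<rho>\<^sup>2) = 2 * D0"
    using lebesgue_integral_dilation[OF borel_measurable_integrable[OF int1] assms] assms
    by (simp add: D0)
  ultimately have "has_bochner_integral lebesgue (\<lambda>x. ?g (x /\<^sub>R \<rho>) / \<rho>\<^sup>2) (2 * D0)"
    by (simp only: has_bochner_integral_iff)
  then show ?thesis
    by (rule has_bochner_integral_lebesgue_AE[OF _ weak_grad_sq_trial_map[OF assms]])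
qed

text \<open>The squared Laplacian scales by rho^-4, against rho^2 from the area element.\<close>

lemma weak_laplacian_trial_map_integral:
  assumes "0 < \<rho>"
  shows "has_bochner_integral lebesgue (\<lambda>x. (norm (weak_laplacian (trial_map \<rho>) x))\<^sup>2) (A0 / \<rho>\<^sup>2)"
proof -
  let ?l = "\<lambda>x. (norm (\<Sum>i\<in>UNIV. trial_hess i i x))\<^sup>2"
  have AE: "AE x in lebesgue. (norm (weak_laplacian (trial_map \<rho>) x))\<^sup>2 = ?l (x /\<^sub>R \<rho>) / (\<rho>\<^sup>2)\<^sup>2" if "0 < \<rho>" for \<rho>
    using weak_laplacian_trial_map[OF that]
    by eventually_elim (simp only: power2_norm_divideR)
  have int1: "integrable lebesgue ?l"
    using weak_laplacian_sq_integrable[OF zero_less_one] by simp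
  have "AE x in lebesgue. (norm (weak_laplacian (trial_map 1) x))\<^sup>2 = ?l x"
    using AE[OF zero_less_one] by simp
  with has_bochner_integral_integrable[OF int1]
  have "has_bochner_integral lebesgue (\<lambda>x. (norm (weak_laplacian (trial_map 1) x))\<^sup>2) (LINT x|lebesgue. ?l x)"
    by (rule has_bochner_integral_lebesgue_AE)
  then have A0: "A0 = (LINT x|lebesgue. ?l x)"
    by (simp add: A0_def has_bochner_integral_iff)
  have "integrable lebesgue (\<lambda>x. ?l (x /\<^sub>R \<rho>) / (\<rho>\<^sup>2)\<^sup>2)"
    using weak_laplacian_sq_integrable[OF assms] by (simp only: power2_norm_divideR)
  moreover have "(LINT x|lebesgue. ?l (x /\<^sub>R \<rho>) / (\<rho>\<^sup>2)\<^sup>2) = A0 / \<rho>\<^sup>2"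
    using lebesgue_integral_dilation[OF borel_measurable_integrable[OF int1] assms] assms
    by (simp add: A0 power2_eq_square power4_eq_xxxx)
  ultimately have "has_bochner_integral lebesgue (\<lambda>x. ?l (x /\<^sub>R \<rho>) / (\<rho>\<^sup>2)\<^sup>2) (A0 / \<rho>\<^sup>2)"
    by (simp only: has_bochner_integral_iff)
  then show ?thesis
    by (rule has_bochner_integral_lebesgue_AE[OF _ AE[OF assms]])
qed

lemma trial_map_potential_integral:
  assumes "0 < \<rho>"
  shows "has_bochner_integral lebesgue (\<lambda>x. (norm (trial_map \<rho> x - e3))\<^sup>2) (\<rho>\<^sup>2 * P0)"
proof -
  have int: "integrable lebesgue (\<lambda>x. (norm (trial_map \<rho> x - e3))\<^sup>2)" if "0 < \<rho>" for \<rho>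
    using trial_map_diff_e3_H2[OF that] by (simp add: H2_def L2_def)
  have "(LINT x|lebesgue. (norm (trial_map \<rho> x - e3))\<^sup>2) = \<rho>\<^sup>2 * P0"
    unfolding trial_map_scale[OF assms] P0_def
    by (rule lebesgue_integral_dilation[OF borel_measurable_integrable[OF int[OF zero_less_one]] assms])
  then show ?thesis
    using int[OF assms] by (simp add: has_bochner_integral_iff)
qed

lemma energy_trial_map:
  assumes "0 < \<rho>"
  shows "energy \<epsilon> (trial_map \<rho>) = (A0 / \<rho>\<^sup>2 + \<rho>\<^sup>2 * P0) / 2 - \<epsilon> * D0"
proof -
  have "has_bochner_integral lebesgue (\<lambda>x. (norm (weak_laplacian (trial_map \<rho>) x))\<^sup>2 +
      (norm (trial_map \<rho> x - e3))\<^sup>2 - \<epsilon> * weak_grad_sq (trial_map \<rho>) x) (A0 / \<rho>\<^sup>2 + \<rho>\<^sup>2 * P0 - \<epsilon> * (2 * D0))"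
    by (intro has_bochner_integral_diff has_bochner_integral_add has_bochner_integral_mult_right
        weak_laplacian_trial_map_integral trial_map_potential_integral weak_grad_sq_trial_map_integral assms)
  then show ?thesis
    by (simp add: energy_def has_bochner_integral_integral_eq field_simps)
qed

section \<open>Positivity of the constants\<close>

lemma has_bochner_integral_AE_zero:
  fixes f :: "real^2 \<Rightarrow> real"
  assumes "has_bochner_integral lebesgue f 0" "\<And>x. 0 \<le> f x"
  shows "AE x in lebesgue. f x = 0"
  using assms integral_nonneg_eq_0_iff_AE[of lebesgue f] by (simp add: has_bochner_integral_iff)

text \<open>The ball has positive measure, so a property valid almost everywhere holds at some point
  of the punctured disc, where the pointwise identities apply. Both positivity proofs reach their
  contradiction at such a point.\<close>

lemma AE_ball_witness:
  assumes "AE x in lebesgue. P (x :: real^2)"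
  obtains x where "x \<noteq> 0" "norm x < 1" "P x"
proof -
  have "AE x in lebesgue. P x \<and> x \<noteq> 0"
    using assms AE_regular[OF zero_less_one] by eventually_elim simp
  moreover have "\<not> (AE x in lebesgue. x \<notin> ball (0::real^2) 1)"
  proof
    assume "AE x in lebesgue. x \<notin> ball (0::real^2) 1"
    then have "ball (0::real^2) 1 \<in> null_sets lebesgue"
      unfolding completion.AE_iff_null_sets by (simp add: ball_def)
    then show False
      using content_ball_gt_0_iff[of "0::real^2" 1] by (auto simp: null_sets_def measure_def)
  qed
  ultimately have "\<exists>x. P x \<and> x \<noteq> 0 \<and> x \<in> ball 0 1"
    by (metis (mono_tags, lifting) AE_mp AE_I2)
  then show thesis using that by auto
qed

lemma P0_pos: "0 < P0"
proof -
  have int: "has_bochner_integral lebesgue (\<lambda>x. (norm (trial_map 1 x - e3))\<^sup>2) P0"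
    using trial_map_potential_integral[OF zero_less_one] by simp
  have "P0 \<noteq> 0"
  proof
    assume "P0 = 0"
    then have "AE x in lebesgue. (norm (trial_map 1 x - e3))\<^sup>2 = 0"
      using int by (intro has_bochner_integral_AE_zero) auto
    then obtain x :: "real^2" where x: "x \<noteq> 0" "norm x < 1" "trial_map 1 x = e3"
      using AE_ball_witness[of "\<lambda>x. (norm (trial_map 1 x - e3))\<^sup>2 = 0"] by auto
    \<comment> \<open>Inside the punctured disc f lies strictly between 0 and pi, so the map differs
      from the north pole there.\<close>
    have "(1 - norm x)\<^sup>2 < 1"
      using x power_strict_mono[of "1 - norm x" 1 2] by simp
    then have "0 < profile (norm x)" "profile (norm x) < pi"
      using x by (auto simp: profile_def)
    then have "cos (profile (norm x)) < 1"
      using cos_monotone_0_pi[of 0 "profile (norm x)"] by simp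
    moreover have "trial_map 1 x $ 3 = 1"
      using x by (simp add: e3_def)
    ultimately show False by (simp add: trial_map_def)
  qed
  moreover have "0 \<le> P0"
    unfolding P0_def by simp
  ultimately show ?thesis by simp
qed

lemma A0_pos: "0 < A0"
proof -
  have int: "has_bochner_integral lebesgue (\<lambda>x. (norm (weak_laplacian (trial_map 1) x))\<^sup>2) A0"
    using weak_laplacian_trial_map_integral[OF zero_less_one] by simp
  have "A0 \<noteq> 0"
  proof
    assume "A0 = 0"
    then have "AE x in lebesgue. (norm (weak_laplacian (trial_map 1) x))\<^sup>2 = 0"
      using int by (intro has_bochner_integral_AE_zero) auto
    then have "AE x in lebesgue. (\<Sum>i\<in>UNIV. trial_hess i i x) = 0"
      using weak_laplacian_trial_map[OF zero_less_one] by eventually_elim simp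
    then obtain x :: "real^2" where x: "x \<noteq> 0" "norm x < 1" "(\<Sum>i\<in>UNIV. trial_hess i i x) = 0"
      by (rule AE_ball_witness)
    then have "(\<Sum>i\<in>UNIV. (norm (trial_grad i x))\<^sup>2) = 0"
      using trial_map_inner_laplacian[of x] by simp
    then have "(profile' (norm x))\<^sup>2 + (sin (profile (norm x)) / norm x)\<^sup>2 = 0"
      using sum_trial_grad_sq[OF x(1)] by simp
    then have "profile' (norm x) = 0"
      by (simp add: sum_power2_eq_zero_iff)
    then show False using x by (simp add: profile'_def)
  qed
  moreover have "0 \<le> A0"
    unfolding A0_def by simp
  ultimately show ?thesis by simp
qed

section \<open>The bound on the Dirichlet energy\<close>

lemma D0_le: "D0 \<le> 12 * pi"
proof -
  define b where "b r = (if r \<le> 1 then 4 * pi\<^sup>2 * (1 - r)\<^sup>2 + 2 * pi / r else 0)" for r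
  have [measurable]: "b \<in> borel_measurable borel"
    unfolding b_def[abs_def] by measurable
  \<comment> \<open>An antiderivative of 2 pi r \<open>b r\<close> on the unit interval; the weight
    r makes the singular term 2 pi / r harmless.\<close>
  let ?F = "\<lambda>r. 8 * pi ^ 3 * (r\<^sup>2 / 2 - 2 * r ^ 3 / 3 + r ^ 4 / 4) + 4 * pi\<^sup>2 * r"
  have "has_bochner_integral lborel (\<lambda>r. indicat_real {0..1} r *\<^sub>R (8 * pi ^ 3 * (r * (1 - r)\<^sup>2) + 4 * pi\<^sup>2)) (?F 1 - ?F 0)"
  proof (subst has_bochner_integral_iff, intro conjI)
    show "integrable lborel (\<lambda>r. indicat_real {0..1} r *\<^sub>R (8 * pi ^ 3 * (r * (1 - r)\<^sup>2) + 4 * pi\<^sup>2))"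
      by (intro borel_integrable_compact continuous_intros) auto
    show "(LINT r|lborel. indicat_real {0..1} r *\<^sub>R (8 * pi ^ 3 * (r * (1 - r)\<^sup>2) + 4 * pi\<^sup>2)) = ?F 1 - ?F 0"
    proof (rule integral_FTC_atLeastAtMost)
      show "(?F has_vector_derivative 8 * pi ^ 3 * (r * (1 - r)\<^sup>2) + 4 * pi\<^sup>2) (at r within {0..1})" for r
        unfolding has_real_derivative_iff_has_vector_derivative[symmetric]
        by (auto intro!: derivative_eq_intros simp: power2_eq_square power3_eq_cube algebra_simps)
    qed (auto intro!: continuous_intros)
  qed
  then have "has_bochner_integral lborel (\<lambda>r. 2 * pi * max 0 r * b r) (?F 1 - ?F 0)"
  proof (rule has_bochner_integral_cong_AE[THEN iffD1, rotated -1])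
    \<comment> \<open>At r = 0 the left integrand is 4 pi^2 and the right one is 0, so the two agree
      only almost everywhere.\<close>
    have "AE r in lborel. r \<noteq> (0::real)" by (rule AE_lborel_singleton)
    then show "AE r in lborel. indicat_real {0..1} r *\<^sub>R (8 * pi ^ 3 * (r * (1 - r)\<^sup>2) + 4 * pi\<^sup>2) = 2 * pi * max 0 r * b r"
      by eventually_elim (auto simp: b_def indicator_def max_def power2_eq_square power3_eq_cube field_simps)
  qed measurable
  from has_bochner_integral_radial[OF _ this]
  have B: "has_bochner_integral lebesgue (\<lambda>x::real^2. b (norm x)) (?F 1 - ?F 0)" by simp
  have G: "has_bochner_integral lebesgue (weak_grad_sq (trial_map 1)) (2 * D0)"
    by (rule weak_grad_sq_trial_map_integral) simp
  have "(LINT x|lebesgue. weak_grad_sq (trial_map 1) x) \<le> (LINT x|lebesgue. b (norm (x::real^2)))"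
  proof (rule integral_mono_AE)
    show "AE x in lebesgue. weak_grad_sq (trial_map 1) x \<le> b (norm x)"
      using weak_grad_sq_trial_map[OF zero_less_one] AE_regular[OF zero_less_one]
    proof eventually_elim
      case (elim x)
      define r where "r = norm x"
      have r: "0 < r" using elim by (simp add: r_def)
      have eq: "weak_grad_sq (trial_map 1) x = (profile' r)\<^sup>2 + (sin (profile r) / r)\<^sup>2"
        using elim sum_trial_grad_sq[of x] by (simp add: r_def)
      show ?case
      proof (cases "r \<le> 1")
        case True
        \<comment> \<open>Applied to both factors of the square, this estimate would contribute 2
          pi^3 to the bound on \<open>D0\<close>, already more than 12 pi. Using |sin| <= 1 for one
          of them contributes 2 pi^2 instead.\<close>
        have "\<bar>sin (profile r)\<bar> \<le> 2 * pi * r"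
          using lipschitz_onD[OF lipschitz_on_sin_profile, of r 0] r by (simp add: dist_real_def profile_def)
        then have "\<bar>sin (profile r)\<bar> * \<bar>sin (profile r)\<bar> \<le> 1 * (2 * pi * r)"
          by (intro mult_mono) auto
        then have "(sin (profile r) / r)\<^sup>2 \<le> 2 * pi / r"
          using r by (simp add: power_divide power2_eq_square field_simps)
        moreover have "(profile' r)\<^sup>2 = 4 * pi\<^sup>2 * (1 - r)\<^sup>2"
          using True by (simp add: profile'_def power_mult_distrib)
        ultimately show ?thesis
          using True unfolding eq by (simp add: b_def flip: r_def)
      next
        case False
        then show ?thesis unfolding eq by (simp add: b_def profile'_def profile_def flip: r_def)
      qed
    qed
  qed (use B G in \<open>auto simp: has_bochner_integral_iff\<close>)
  then have "2 * D0 \<le> ?F 1 - ?F 0"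
    using B G by (simp only: has_bochner_integral_integral_eq)
  then have "D0 \<le> pi * (pi * pi / 3 + 2 * pi)"
    by (simp add: power2_eq_square power3_eq_cube algebra_simps)
  also have "\<dots> \<le> pi * 12"
  proof (intro mult_left_mono)
    \<comment> \<open>A crude rational bound is enough: it gives a value below 9.82.\<close>
    have pi: "pi \<le> 16 / 5" using pi_approx by simp
    then have "pi * pi \<le> 16 / 5 * (16 / 5)" by (intro mult_mono) auto
    then show "pi * pi / 3 + 2 * pi \<le> 12" using pi by simp
  qed simp
  finally show ?thesis by simp
qed

section \<open>The topological degree\<close>

text \<open>The radial integrand is the derivative of -2 pi cos f, so the degree depends only on the
  endpoint values f(0) = pi and f(1) = 0. The powers of rho cancel as they do for the Dirichlet
  energy.\<close>

lemma top_degree_trial_map: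
  assumes "0 < \<rho>"
  shows "top_degree (trial_map \<rho>) = - 1"
proof -
  let ?k = "\<lambda>r. sin (profile r) / r * profile' r"
  let ?q = "\<lambda>r. 2 * pi * (sin (profile r) * profile' r)"
  have cont: "continuous_on S profile" "continuous_on S profile'" for S
    unfolding profile_eq[abs_def] profile'_def by (intro continuous_intros)+
  then have [measurable]: "profile \<in> borel_measurable borel" "profile' \<in> borel_measurable borel"
    by (auto intro: borel_measurable_continuous_onI)
  have "sin (profile 0) = 0" by (simp add: profile_def)
  have "has_bochner_integral lborel (\<lambda>r. indicat_real {0..1} r *\<^sub>R ?q r)
      (- 2 * pi * cos (profile 1) - (- 2 * pi * cos (profile 0)))"
  proof (subst has_bochner_integral_iff, intro conjI)
    show "integrable lborel (\<lambda>r. indicat_real {0..1} r *\<^sub>R ?q r)"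
      by (intro borel_integrable_compact continuous_intros cont) auto
    show "(LINT r|lborel. indicat_real {0..1} r *\<^sub>R ?q r) = - 2 * pi * cos (profile 1) - (- 2 * pi * cos (profile 0))"
    proof (rule integral_FTC_atLeastAtMost)
      show "((\<lambda>r. - 2 * pi * cos (profile r)) has_vector_derivative ?q r) (at r within {0..1})" for r
        unfolding has_real_derivative_iff_has_vector_derivative[symmetric]
        by (auto intro!: derivative_eq_intros)
    qed (auto intro!: continuous_intros cont)
  qed
  also have "- 2 * pi * cos (profile 1) - (- 2 * pi * cos (profile 0)) = - 4 * pi"
    by (simp add: profile_def)
  \<comment> \<open>The integrands agree everywhere: at r = 0 both vanish since sin (f(0)) = 0, and
    beyond r = 1 since \<open>profile'\<close> does.\<close>
  finally have "has_bochner_integral lborel (\<lambda>r. 2 * pi * max 0 r * ?k r) (- 4 * pi)"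
    by (rule has_bochner_integral_cong[THEN iffD1, rotated -1])
       (auto simp: indicator_def max_def profile'_def \<open>sin (profile 0) = 0\<close>)
  from has_bochner_integral_radial[OF _ this]
  have I: "has_bochner_integral lebesgue (\<lambda>x::real^2. ?k (norm x)) (- 4 * pi)" by simp
  have "(LINT x|lebesgue. trial_map \<rho> x \<bullet> cross3 (weak_partial 1 (trial_map \<rho>) x) (weak_partial 2 (trial_map \<rho>) x)) =
      (LINT x|lebesgue. ?k (norm ((x :: real^2) /\<^sub>R \<rho>)) / \<rho>\<^sup>2)"
  proof -
    have AE: "AE x in lebesgue. trial_map \<rho> x \<bullet> cross3 (weak_partial 1 (trial_map \<rho>) x) (weak_partial 2 (trial_map \<rho>) x) =
        ?k (norm (x /\<^sub>R \<rho>)) / \<rho>\<^sup>2"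
      using weak_partial_trial_map[OF assms, of 1] weak_partial_trial_map[OF assms, of 2] AE_regular[OF assms]
    proof eventually_elim
      case (elim x)
      then have "x /\<^sub>R \<rho> \<noteq> 0" using assms by simp
      from trial_map_degree_density[OF this] elim show ?case
        unfolding trial_map_scale[OF assms]
        by (simp add: cross_mult_left cross_mult_right power2_eq_square divide_inverse mult_ac)
    qed
    have "(\<lambda>x::real^2. ?k (norm (x /\<^sub>R \<rho>)) / \<rho>\<^sup>2) \<in> borel_measurable lborel"
      by measurable
    then have m: "(\<lambda>x::real^2. ?k (norm (x /\<^sub>R \<rho>)) / \<rho>\<^sup>2) \<in> borel_measurable lebesgue"
      by (rule measurable_completion)
    have m': "(\<lambda>x. trial_map \<rho> x \<bullet> cross3 (weak_partial 1 (trial_map \<rho>) x) (weak_partial 2 (trial_map \<rho>) x))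
        \<in> borel_measurable lebesgue"
      by (rule borel_measurable_AE[OF m]) (use AE in auto)
    show ?thesis
      by (rule integral_cong_AE[OF m' m AE])
  qed
  also have "\<dots> = (LINT x|lebesgue. ?k (norm ((x :: real^2) /\<^sub>R \<rho>))) / \<rho>\<^sup>2"
    by (rule integral_divide_zero)
  also have "(LINT x|lebesgue. ?k (norm ((x :: real^2) /\<^sub>R \<rho>))) = \<rho>\<^sup>2 * (LINT x|lebesgue. ?k (norm (x :: real^2)))"
    by (rule lebesgue_integral_dilation[OF borel_measurable_integrable[OF integrable.intros[OF I]] assms])
  also have "(LINT x|lebesgue. ?k (norm (x :: real^2))) = - 4 * pi"
    using I by (rule has_bochner_integral_integral_eq)
  also have "\<rho>\<^sup>2 * (- 4 * pi) / \<rho>\<^sup>2 = - 4 * pi"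
    using assms by simp
  finally show ?thesis by (simp add: top_degree_def)
qed

theorem proposition2p6:
  fixes \<epsilon> :: real
  assumes "0 \<le> \<epsilon>" and "\<epsilon> \<le> 2"
  shows "min_energy (-1) \<epsilon> \<le> ereal (energy \<epsilon> (trial_map rho_star)) \<and>
    energy \<epsilon> (trial_map rho_star) \<le> 2 * b_star + 24 * pi * (1 - \<epsilon> / 2) - delta_star"
proof
  have rho: "0 < rho_star"
    using A0_pos P0_pos by (simp add: rho_star_def)
  have "trial_map rho_star \<in> admissible_deg (-1)"
    using trial_map_admissible[OF rho] top_degree_trial_map[OF rho] by (simp add: admissible_deg_def)
  then show "min_energy (-1) \<epsilon> \<le> ereal (energy \<epsilon> (trial_map rho_star))"
    unfolding min_energy_def by (rule INF_lower)
  have "(rho_star\<^sup>2)\<^sup>2 = A0 / P0"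
    using A0_pos P0_pos by (simp add: rho_star_def flip: power_mult)
  then have rho2: "rho_star\<^sup>2 = sqrt A0 / sqrt P0"
    using real_sqrt_unique[of "rho_star\<^sup>2" "A0 / P0"] by (simp add: real_sqrt_divide)
  \<comment> \<open>The radius \<open>rho_star\<close> equalises the bending and potential terms,
    the equality case of the arithmetic-geometric mean inequality.\<close>
  have "A0 / rho_star\<^sup>2 = sqrt (A0 * P0)" "rho_star\<^sup>2 * P0 = sqrt (A0 * P0)"
    using A0_pos P0_pos real_sqrt_mult_self[of A0] real_sqrt_mult_self[of P0]
    by (auto simp: rho2 real_sqrt_mult field_simps)
  then have "energy \<epsilon> (trial_map rho_star) = sqrt (A0 * P0) - \<epsilon> * D0"
    using energy_trial_map[OF rho] by simp
  \<comment> \<open>The claimed bound exceeds the energy by exactly (2 - \<epsilon>) (12 pi -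
    \<open>D0\<close>); the assumption \<epsilon> \<le> 2 fixes the sign of the first
    factor.\<close>
  moreover have "(2 - \<epsilon>) * D0 \<le> (2 - \<epsilon>) * (12 * pi)"
    using D0_le assms by (intro mult_left_mono) auto
  ultimately show "energy \<epsilon> (trial_map rho_star) \<le> 2 * b_star + 24 * pi * (1 - \<epsilon> / 2) - delta_star"
    by (simp add: delta_star_def algebra_simps)
qed

end
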